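(* Let $M$ be a connected smooth manifold of dimension $n\geq 3$, let $A\subseteq TM\setminus\mathbf{0}$ be open and conic with $\pi(A)=M$, and let $L\colon A\to\mathbb{R}$ be a pseudo-Finsler metric whose Ricci scalar $\mathrm{Ric}$ is quadratic. If $(M,L)$ is Einstein, i.e. $\mathrm{Ric}=\rho L$ on $A$ for some smooth function $\rho\colon M\to\mathbb{R}$, then either $(M,L)$ is globally Ricci-flat ($\mathrm{Ric}=0$ on all of $A$), or $L$ is globally pseudo-Riemannian (there is a pseudo-Riemannian metric $h$ on $M$ with $L(x,y)=h_x(y,y)$ for all $(x,y)\in A$) with constant Ricci curvature $\mathrm{Ric}/L$ (i.e. $\mathrm{Ric}=cL$ on $A$ for a constant $c\in\mathbb{R}$).
   Context: $\pi\colon TM\to M$ is the tangent bundle projection and $TM\setminus\mathbf{0}$ the slit tangent bundle. $(x^i)$ are local coordinates on $M$ and $(x^i,y^i)$ the induced natural coordinates on $TM$; the Einstein summation convention is used. A subset $A\subseteq TM\setminus\mathbf{0}$ is conic if $(x,y)\in A$ implies $(x,\mu y)\in A$ for all $\mu>0$. A function $f$ on $A$ is $2$-homogeneous if $f(x,\mu y)=\mu^2f(x,y)$ for all $(x,y)\in A$, $\mu>0$. A pseudo-Finsler metric defined on $A$ is a smooth $2$-homogeneous function $L\colon A\to\mathbb{R}$ such that $g_{ij}(x,y)=\frac12\frac{\partial^2L}{\partial y^i\partial y^j}(x,y)$ is non-degenerate at every $(x,y)\in A$; $(g^{ij})$ denotes the inverse matrix. Spray coefficients: $G^i=\frac14 g^{ic}\left(\frac{\partial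 g_{cb}}{\partial x^a}+\frac{\partial g_{ac}}{\partial x^b}-\frac{\partial g_{ab}}{\partial x^c}\right)y^ay^b$. Ricci scalar (a $2$-homogeneous function on $A$): $\mathrm{Ric}=2\frac{\partial G^i}{\partial x^i}-y^j\frac{\partial^2G^i}{\partial x^j\partial y^i}+2G^j\frac{\partial^2G^i}{\partial y^j\partial y^i}-\frac{\partial G^i}{\partial y^j}\frac{\partial G^j}{\partial y^i}$. A smooth $2$-homogeneous function $f$ on $A$ is called quadratic if there is a $2$-covariant tensor field $h$ on $M$ such that $f(x,y)=h_{ij}(x)y^iy^j$ for all $(x,y)\in A$. *)

theory Defs
  imports "HOL-Analysis.Analysis"
begin

section \<open>Smooth maps between Euclidean spaces\<close>

text \<open>
  Meant for open \<open>S\<close> and finite-dimensional domains, where having continuous iterated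
  directional derivatives up to order \<open>k\<close> is the usual notion of class \<open>C\<^sup>k\<close>. Only the
  values of the function on \<open>S\<close> matter then.
\<close>

primrec Ck_on :: "nat \<Rightarrow> ('a::euclidean_space \<Rightarrow> 'b::real_normed_vector) \<Rightarrow> 'a set \<Rightarrow> bool" where
  "Ck_on 0 f S \<longleftrightarrow> continuous_on S f"
| "Ck_on (Suc k) f S \<longleftrightarrow>
     (\<forall>x\<in>S. f differentiable (at x)) \<and>
     (\<forall>v. Ck_on k (\<lambda>x. frechet_derivative f (at x) v) S)"

definition smooth_on :: "('a::euclidean_space \<Rightarrow> 'b::real_normed_vector) \<Rightarrow> 'a set \<Rightarrow> bool" where
  "smooth_on f S \<longleftrightarrow> (\<forall>k. Ck_on k f S)"


section \<open>Smooth manifolds\<close>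

text \<open>
  A chart is a pair of a coordinate domain and a coordinate map; the values of the
  coordinate map outside the domain are irrelevant. The dimension is \<open>CARD('n)\<close>.
\<close>

type_synonym ('m, 'n) chart = "'m set \<times> ('m \<Rightarrow> real^'n)"

definition chart_on :: "'m topology \<Rightarrow> ('m, 'n::finite) chart \<Rightarrow> bool" where
  "chart_on M c \<longleftrightarrow>
     openin M (fst c) \<and> open (snd c ` fst c) \<and>
     homeomorphic_map (subtopology M (fst c)) (top_of_set (snd c ` fst c)) (snd c)"

definition transition :: "('m, 'n::finite) chart \<Rightarrow> ('m, 'n) chart \<Rightarrow> real^'n \<Rightarrow> real^'n" where
  "transition c d = snd d \<circ> inv_into (fst c) (snd c)"

text \<open>
  The atlas need not be maximal: it determines the smooth structure, and the notions
  below depend only on that structure.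
\<close>

definition smooth_manifold :: "'m topology \<Rightarrow> ('m, 'n::finite) chart set \<Rightarrow> bool" where
  "smooth_manifold M At \<longleftrightarrow>
     Hausdorff_space M \<and> second_countable M \<and>
     (\<forall>c\<in>At. chart_on M c) \<and> (\<Union>c\<in>At. fst c) = topspace M \<and>
     (\<forall>c\<in>At. \<forall>d\<in>At. smooth_on (transition c d) (snd c ` (fst c \<inter> fst d)))"

definition smooth_fun :: "('m, 'n::finite) chart set \<Rightarrow> ('m \<Rightarrow> real) \<Rightarrow> bool" where
  "smooth_fun At f \<longleftrightarrow> (\<forall>c\<in>At. smooth_on (f \<circ> inv_into (fst c) (snd c)) (snd c ` fst c))"


section \<open>The tangent bundle\<close>

text \<open>
  A tangent vector at \<open>x\<close> is the family of its component vectors in all charts around \<open>x\<close>,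
  related by the derivatives of the transition maps. The family is zero at all other
  indices, so that vectors are determined by their components and linear combinations can
  be taken pointwise.
\<close>

type_synonym ('m, 'n) tvec = "('m, 'n) chart \<Rightarrow> real^'n"

definition tangent_space ::
    "('m, 'n::finite) chart set \<Rightarrow> 'm \<Rightarrow> ('m, 'n) tvec set" where
  "tangent_space At x = {v.
     (\<forall>c\<in>At. \<forall>d\<in>At. x \<in> fst c \<longrightarrow> x \<in> fst d \<longrightarrow>
        v d = frechet_derivative (transition c d) (at (snd c x)) (v c)) \<and>
     (\<forall>c. \<not> (c \<in> At \<and> x \<in> fst c) \<longrightarrow> v c = 0)}"

definition tzero :: "('m, 'n::finite) tvec" where
  "tzero = (\<lambda>c. 0)"

definition tscale :: "real \<Rightarrow> ('m, 'n::finite) tvec \<Rightarrow> ('m, 'n) tvec" where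
  "tscale a v = (\<lambda>c. a *\<^sub>R v c)"

definition tadd :: "('m, 'n::finite) tvec \<Rightarrow> ('m, 'n) tvec \<Rightarrow> ('m, 'n) tvec" where
  "tadd v w = (\<lambda>c. v c + w c)"

definition tangent_bundle ::
    "('m, 'n::finite) chart set \<Rightarrow> 'm set \<Rightarrow> ('m \<times> ('m, 'n) tvec) set" where
  "tangent_bundle At U = Sigma U (tangent_space At)"

definition slit_tangent_bundle ::
    "('m, 'n::finite) chart set \<Rightarrow> 'm set \<Rightarrow> ('m \<times> ('m, 'n) tvec) set" where
  "slit_tangent_bundle At U = {z \<in> tangent_bundle At U. snd z \<noteq> tzero}"

text \<open>
  The natural coordinates \<open>(x\<^sup>i, y\<^sup>i)\<close> on the part of the tangent bundle over the domain of a
  chart, and their inverse.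
\<close>

definition nat_coords ::
    "('m, 'n::finite) chart \<Rightarrow> 'm \<times> ('m, 'n) tvec \<Rightarrow> (real^'n) \<times> (real^'n)" where
  "nat_coords c z = (snd c (fst z), snd z c)"

definition nat_coords_inv ::
    "('m, 'n::finite) chart set \<Rightarrow> ('m, 'n) chart \<Rightarrow> (real^'n) \<times> (real^'n) \<Rightarrow> 'm \<times> ('m, 'n) tvec" where
  "nat_coords_inv At c = inv_into (tangent_bundle At (fst c)) (nat_coords c)"

definition coord_image ::
    "('m, 'n::finite) chart set \<Rightarrow> ('m, 'n) chart \<Rightarrow> ('m \<times> ('m, 'n) tvec) set
      \<Rightarrow> ((real^'n) \<times> (real^'n)) set" where
  "coord_image At c A = nat_coords c ` (A \<inter> tangent_bundle At (fst c))"

definition coord_rep ::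
    "('m, 'n::finite) chart set \<Rightarrow> ('m, 'n) chart \<Rightarrow> ('m \<times> ('m, 'n) tvec \<Rightarrow> real)
      \<Rightarrow> (real^'n) \<times> (real^'n) \<Rightarrow> real" where
  "coord_rep At c f = f \<circ> nat_coords_inv At c"

definition open_in_bundle ::
    "('m, 'n::finite) chart set \<Rightarrow> ('m \<times> ('m, 'n) tvec) set \<Rightarrow> bool" where
  "open_in_bundle At A \<longleftrightarrow> (\<forall>c\<in>At. open (coord_image At c A))"

definition smooth_fun_bundle ::
    "('m, 'n::finite) chart set \<Rightarrow> ('m \<times> ('m, 'n) tvec) set \<Rightarrow> ('m \<times> ('m, 'n) tvec \<Rightarrow> real) \<Rightarrow> bool" where
  "smooth_fun_bundle At A f \<longleftrightarrow> (\<forall>c\<in>At. smooth_on (coord_rep At c f) (coord_image At c A))"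

definition conic_subset :: "('m \<times> ('m, 'n::finite) tvec) set \<Rightarrow> bool" where
  "conic_subset A \<longleftrightarrow> (\<forall>x v \<mu>. (x, v) \<in> A \<longrightarrow> \<mu> > 0 \<longrightarrow> (x, tscale \<mu> v) \<in> A)"

definition homogeneous2 ::
    "('m \<times> ('m, 'n::finite) tvec) set \<Rightarrow> ('m \<times> ('m, 'n) tvec \<Rightarrow> real) \<Rightarrow> bool" where
  "homogeneous2 A f \<longleftrightarrow> (\<forall>x v \<mu>. (x, v) \<in> A \<longrightarrow> \<mu> > 0 \<longrightarrow> f (x, tscale \<mu> v) = \<mu>\<^sup>2 * f (x, v))"


section \<open>Pseudo-Finsler metrics and their Ricci scalar\<close>

definition dx :: "'n::finite \<Rightarrow> ((real^'n) \<times> (real^'n) \<Rightarrow> real) \<Rightarrow> (real^'n) \<times> (real^'n) \<Rightarrow> real" where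
  "dx i F z = frechet_derivative F (at z) (axis i 1, 0)"

definition dy :: "'n::finite \<Rightarrow> ((real^'n) \<times> (real^'n) \<Rightarrow> real) \<Rightarrow> (real^'n) \<times> (real^'n) \<Rightarrow> real" where
  "dy i F z = frechet_derivative F (at z) (0, axis i 1)"

text \<open>In this part, \<open>F\<close> is the expression of \<open>L\<close> in natural coordinates \<open>z = (x, y)\<close>.\<close>

definition fund_tensor :: "((real^'n) \<times> (real^'n) \<Rightarrow> real) \<Rightarrow> (real^'n) \<times> (real^'n) \<Rightarrow> real^'n^'n::finite" where
  "fund_tensor F z = (\<chi> i j. (1/2) * dy i (dy j F) z)"

definition spray_coeff ::
    "((real^'n::finite) \<times> (real^'n) \<Rightarrow> real) \<Rightarrow> 'n \<Rightarrow> (real^'n) \<times> (real^'n) \<Rightarrow> real" where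
  "spray_coeff F i z =
     (let g = (\<lambda>a b z. fund_tensor F z $ a $ b); ginv = matrix_inv (fund_tensor F z); y = snd z
      in (1/4) * (\<Sum>c\<in>UNIV. \<Sum>a\<in>UNIV. \<Sum>b\<in>UNIV.
            ginv $ i $ c * (dx a (g c b) z + dx b (g a c) z - dx c (g a b) z) * y $ a * y $ b))"

definition ricci_coord ::
    "((real^'n::finite) \<times> (real^'n) \<Rightarrow> real) \<Rightarrow> (real^'n) \<times> (real^'n) \<Rightarrow> real" where
  "ricci_coord F z =
     (let G = spray_coeff F; y = snd z
      in 2 * (\<Sum>i\<in>UNIV. dx i (G i) z)
         - (\<Sum>i\<in>UNIV. \<Sum>j\<in>UNIV. y $ j * dx j (dy i (G i)) z)
         + 2 * (\<Sum>i\<in>UNIV. \<Sum>j\<in>UNIV. G j z * dy j (dy i (G i)) z)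
         - (\<Sum>i\<in>UNIV. \<Sum>j\<in>UNIV. dy j (G i) z * dy i (G j) z))"

definition pseudo_finsler ::
    "('m, 'n::finite) chart set \<Rightarrow> ('m \<times> ('m, 'n) tvec) set \<Rightarrow> ('m \<times> ('m, 'n) tvec \<Rightarrow> real) \<Rightarrow> bool" where
  "pseudo_finsler At A L \<longleftrightarrow>
     smooth_fun_bundle At A L \<and> homogeneous2 A L \<and>
     (\<forall>c\<in>At. \<forall>z\<in>coord_image At c A. invertible (fund_tensor (coord_rep At c L) z))"

text \<open>
  The coordinate expression does not depend on the chart, so any chart around the base
  point may be used.
\<close>

definition ricci_scalar ::
    "('m, 'n::finite) chart set \<Rightarrow> ('m \<times> ('m, 'n) tvec \<Rightarrow> real) \<Rightarrow> 'm \<times> ('m, 'n) tvec \<Rightarrow> real" where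
  "ricci_scalar At L z =
     (let c = (SOME c. c \<in> At \<and> fst z \<in> fst c)
      in ricci_coord (coord_rep At c L) (nat_coords c z))"


section \<open>Tensor fields, quadratic functions, Einstein metrics\<close>

type_synonym ('m, 'n) cov2 = "'m \<Rightarrow> ('m, 'n) tvec \<Rightarrow> ('m, 'n) tvec \<Rightarrow> real"

text \<open>The tangent vector over the point with coordinates \<open>p\<close> having components \<open>w\<close> in chart \<open>c\<close>.\<close>

definition coord_vec ::
    "('m, 'n::finite) chart set \<Rightarrow> ('m, 'n) chart \<Rightarrow> real^'n \<Rightarrow> real^'n \<Rightarrow> ('m, 'n) tvec" where
  "coord_vec At c p w = snd (nat_coords_inv At c (p, w))"

definition tensor_comp ::
    "('m, 'n::finite) chart set \<Rightarrow> ('m, 'n) chart \<Rightarrow> ('m, 'n) cov2 \<Rightarrow> 'n \<Rightarrow> 'n \<Rightarrow> real^'n \<Rightarrow> real" where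
  "tensor_comp At c h i j p =
     h (inv_into (fst c) (snd c) p) (coord_vec At c p (axis i 1)) (coord_vec At c p (axis j 1))"

definition cov2_tensor_field ::
    "'m topology \<Rightarrow> ('m, 'n::finite) chart set \<Rightarrow> ('m, 'n) cov2 \<Rightarrow> bool" where
  "cov2_tensor_field M At h \<longleftrightarrow>
     (\<forall>x\<in>topspace M. \<forall>u\<in>tangent_space At x. \<forall>v\<in>tangent_space At x. \<forall>w\<in>tangent_space At x. \<forall>a.
        h x (tadd u v) w = h x u w + h x v w \<and> h x w (tadd u v) = h x w u + h x w v \<and>
        h x (tscale a u) w = a * h x u w \<and> h x w (tscale a u) = a * h x w u) \<and>
     (\<forall>c\<in>At. \<forall>i j. smooth_on (tensor_comp At c h i j) (snd c ` fst c))"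

definition pseudo_riemannian_metric ::
    "'m topology \<Rightarrow> ('m, 'n::finite) chart set \<Rightarrow> ('m, 'n) cov2 \<Rightarrow> bool" where
  "pseudo_riemannian_metric M At h \<longleftrightarrow>
     cov2_tensor_field M At h \<and>
     (\<forall>x\<in>topspace M. \<forall>v\<in>tangent_space At x. \<forall>w\<in>tangent_space At x. h x v w = h x w v) \<and>
     (\<forall>x\<in>topspace M. \<forall>v\<in>tangent_space At x.
        (\<forall>w\<in>tangent_space At x. h x v w = 0) \<longrightarrow> v = tzero)"

definition quadratic ::
    "'m topology \<Rightarrow> ('m, 'n::finite) chart set \<Rightarrow> ('m \<times> ('m, 'n) tvec) set
      \<Rightarrow> ('m \<times> ('m, 'n) tvec \<Rightarrow> real) \<Rightarrow> bool" where
  "quadratic M At A f \<longleftrightarrow>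
     (\<exists>h. cov2_tensor_field M At h \<and> (\<forall>(x, v)\<in>A. f (x, v) = h x v v))"

definition einstein ::
    "('m, 'n::finite) chart set \<Rightarrow> ('m \<times> ('m, 'n) tvec) set \<Rightarrow> ('m \<times> ('m, 'n) tvec \<Rightarrow> real) \<Rightarrow> bool" where
  "einstein At A L \<longleftrightarrow>
     (\<exists>\<rho>. smooth_fun At \<rho> \<and> (\<forall>(x, v)\<in>A. ricci_scalar At L (x, v) = \<rho> x * L (x, v)))"

end

theory Submission
  imports Defs
begin

text \<open>
  Let \<open>Ric = \<rho> L\<close> with \<open>\<rho>\<close> a function on \<open>M\<close>, and let \<open>Ric(x,y) = h\<^sub>x(y,y)\<close>. Over the open set where
  \<open>\<rho> \<noteq> 0\<close> one has \<open>L = h/\<rho>\<close>, so \<open>L\<close> is a quadratic form in \<open>y\<close> there, and non-degeneracy of the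
  fundamental tensor makes \<open>h/\<rho>\<close> (with \<open>h\<close> symmetrised) a pseudo-Riemannian metric. Its spray is
  \<open>G\<^sup>i = \<Gamma>\<^sup>i(y,y)/2\<close>, so the Finsler Ricci scalar is the quadratic form of the Ricci tensor
  (\<open>ricci_coord_quadratic\<close>), and the hypothesis becomes the Einstein equation of that metric on an open
  cone in each tangent space. A quadratic form that vanishes on a nonempty open set is zero, so the
  Einstein equation holds as an identity of tensors (\<open>einstein_metric\<close>). Schur's lemma in dimension
  at least 3 then gives \<open>d\<rho> = 0\<close> on this set (\<open>schur\<close>).

  Hence, for every \<open>k \<noteq> 0\<close>, the level set \<open>{\<rho> = k}\<close> is open; it is also closed, and \<open>M\<close> is connected.
  If \<open>\<rho>\<close> takes a value \<open>k \<noteq> 0\<close> at all, it is therefore the constant \<open>k\<close>, and \<open>h/k\<close> is the required metric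
  on all of \<open>M\<close>. Otherwise \<open>\<rho> = 0\<close> and \<open>Ric = 0\<close>.

  The Ricci scalar at a point is computed in an arbitrarily chosen chart around that point, and
  the choice may jump from one point to the next. Differentiating the Einstein equation needs it in one
  fixed chart, so the naturality of the Ricci tensor under changes of coordinates
  (\<open>ricci_pullback\<close>) is part of the argument. It is used for quadratic \<open>L\<close> only, where it
  follows from the transformation law of the Christoffel symbols.

  All local geometry is done without indices: a metric is a family \<open>g x\<close> of bilinear forms, the
  Christoffel symbols are a family \<open>\<Gamma> x\<close> of symmetric bilinear maps, and \<open>D f x v\<close> is the derivative of \<open>f\<close> at
  \<open>x\<close> in direction \<open>v\<close>. Schur's lemma is split into the second Bianchi identity and a statement of
  pure linear algebra about the covariant derivative of the curvature at one point
  (\<open>schur_pointwise\<close>).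
\<close>

section \<open>Smooth functions on open sets\<close>

abbreviation D :: "('a::real_normed_vector \<Rightarrow> 'b::real_normed_vector) \<Rightarrow> 'a \<Rightarrow> 'a \<Rightarrow> 'b" where
  "D f x v \<equiv> frechet_derivative f (at x) v"

lemma has_derivative_D: "f differentiable (at x) \<Longrightarrow> (f has_derivative D f x) (at x)"
  using frechet_derivative_works by blast

lemma D_eq: "(f has_derivative f') (at x) \<Longrightarrow> D f x v = f' v"
  using frechet_derivative_at by metis

lemma has_derivative_cong_open:
  assumes "(f has_derivative f') (at x)" "open S" "x \<in> S" "\<And>y. y \<in> S \<Longrightarrow> f y = g y"
  shows "(g has_derivative f') (at x)"
  using assms has_derivative_transform_within_open by blast

lemma D_cong_open:
  assumes "open S" "x \<in> S" "\<And>y. y \<in> S \<Longrightarrow> f y = g y"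
  shows "D f x v = D g x v"
proof -
  have "(f has_derivative f') (at x) \<longleftrightarrow> (g has_derivative f') (at x)" for f'
    using has_derivative_cong_open[OF _ assms(1,2)] assms(3) by metis
  then show ?thesis by (simp add: frechet_derivative_def)
qed

lemma differentiable_cong_open:
  assumes "f differentiable (at x)" "open S" "x \<in> S" "\<And>y. y \<in> S \<Longrightarrow> f y = g y"
  shows "g differentiable (at x)"
  using assms has_derivative_cong_open unfolding differentiable_def by blast

lemma Ck_on_cong:
  assumes "Ck_on k f S" "open S" "\<And>x. x \<in> S \<Longrightarrow> f x = g x"
  shows "Ck_on k g S"
  using assms
proof (induction k arbitrary: f g)
  case 0
  then show ?case using continuous_on_cong by (metis Ck_on.simps(1))
next
  case (Suc k)
  have "Ck_on k (\<lambda>x. D g x v) S" for v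
  proof (rule Suc.IH[of "\<lambda>x. D f x v"])
    show "Ck_on k (\<lambda>x. D f x v) S" using Suc.prems by simp
    show "D f x v = D g x v" if "x \<in> S" for x
      using D_cong_open[OF Suc.prems(2) that Suc.prems(3)] .
  qed fact
  moreover have "g differentiable (at x)" if "x \<in> S" for x
    using differentiable_cong_open[OF _ Suc.prems(2) that Suc.prems(3)] Suc.prems(1) that by simp
  ultimately show ?case by simp
qed

lemma Ck_on_subset: "Ck_on k f S \<Longrightarrow> T \<subseteq> S \<Longrightarrow> Ck_on k f T"
  by (induction k arbitrary: f) (auto intro: continuous_on_subset)

lemma Ck_on_SucD: "Ck_on (Suc k) f S \<Longrightarrow> Ck_on k f S"
proof (induction k arbitrary: f)
  case 0
  then show ?case
    by (auto intro!: continuous_at_imp_continuous_on differentiable_imp_continuous_within)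
next
  case (Suc k)
  then show ?case by (metis Ck_on.simps(2))
qed

lemma Ck_on_const: "Ck_on k (\<lambda>x. c) S"
  by (induction k arbitrary: c) auto

text \<open>
  This is how the closure properties of \<open>Ck_on\<close> are proved below: it suffices to exhibit some
  formula for the derivative on \<open>S\<close>, and to see that this formula is of class one lower.
\<close>

lemma Ck_on_SucI:
  assumes "open S" and d: "\<And>x. x \<in> S \<Longrightarrow> (f has_derivative f' x) (at x)"
    and "\<And>v. Ck_on k (\<lambda>x. f' x v) S"
  shows "Ck_on (Suc k) f S"
proof -
  have "Ck_on k (\<lambda>x. D f x v) S" for v
    by (rule Ck_on_cong[OF assms(3) assms(1)]) (simp add: D_eq[OF d])
  then show ?thesis using d by (auto simp: differentiable_def)
qed

lemma Ck_on_has_derivative: "Ck_on (Suc k) f S \<Longrightarrow> x \<in> S \<Longrightarrow> (f has_derivative D f x) (at x)"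
  by (simp add: has_derivative_D)

lemma Ck_on_D: "Ck_on (Suc k) f S \<Longrightarrow> Ck_on k (\<lambda>x. D f x v) S"
  by simp

lemma Ck_on_bounded_linear:
  assumes "bounded_linear l" "Ck_on k f S" "open S"
  shows "Ck_on k (\<lambda>x. l (f x)) S"
  using assms(2)
proof (induction k arbitrary: f)
  case 0
  then show ?case using bounded_linear.continuous_on[OF assms(1)] by simp
next
  case (Suc k)
  show ?case
    by (rule Ck_on_SucI[OF assms(3) bounded_linear.has_derivative[OF assms(1)
          Ck_on_has_derivative[OF Suc.prems]] Suc.IH[OF Ck_on_D[OF Suc.prems]]])
qed

lemma Ck_on_add:
  assumes "Ck_on k f S" "Ck_on k g S" "open S"
  shows "Ck_on k (\<lambda>x. f x + g x) S"
  using assms(1,2)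
proof (induction k arbitrary: f g)
  case 0
  then show ?case by (simp add: continuous_on_add)
next
  case (Suc k)
  show ?case
    by (rule Ck_on_SucI[OF assms(3) has_derivative_add[OF Ck_on_has_derivative[OF Suc.prems(1)]
          Ck_on_has_derivative[OF Suc.prems(2)]] Suc.IH[OF Ck_on_D[OF Suc.prems(1)] Ck_on_D[OF Suc.prems(2)]]])
qed

lemma Ck_on_scaleR:
  fixes f :: "'a::euclidean_space \<Rightarrow> real"
  assumes "Ck_on k f S" "Ck_on k g S" "open S"
  shows "Ck_on k (\<lambda>x. f x *\<^sub>R g x) S"
  using assms(1,2)
proof (induction k arbitrary: f g)
  case 0
  then show ?case by (simp add: continuous_on_scaleR)
next
  case (Suc k)
  have d: "((\<lambda>x. f x *\<^sub>R g x) has_derivative (\<lambda>v. f x *\<^sub>R D g x v + D f x v *\<^sub>R g x)) (at x)"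
    if "x \<in> S" for x
    by (rule has_derivative_scaleR[OF Ck_on_has_derivative[OF Suc.prems(1) that]
          Ck_on_has_derivative[OF Suc.prems(2) that]])
  have c: "Ck_on k (\<lambda>x. f x *\<^sub>R D g x v + D f x v *\<^sub>R g x) S" for v
    by (rule Ck_on_add[OF Suc.IH[OF Ck_on_SucD[OF Suc.prems(1)] Ck_on_D[OF Suc.prems(2)]]
          Suc.IH[OF Ck_on_D[OF Suc.prems(1)] Ck_on_SucD[OF Suc.prems(2)]] assms(3)])
  show ?case by (rule Ck_on_SucI[OF assms(3) d c])
qed

lemma Ck_on_inverse:
  fixes f :: "'a::euclidean_space \<Rightarrow> real"
  assumes "Ck_on k f S" "open S" "\<And>x. x \<in> S \<Longrightarrow> f x \<noteq> 0"
  shows "Ck_on k (\<lambda>x. inverse (f x)) S"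
  using assms(1)
proof (induction k)
  case 0
  then show ?case using assms(3) by (simp add: continuous_on_inverse)
next
  case (Suc k)
  have i: "Ck_on k (\<lambda>x. inverse (f x)) S" by (rule Suc.IH[OF Ck_on_SucD[OF Suc.prems]])
  have d: "((\<lambda>x. inverse (f x)) has_derivative (\<lambda>v. - (inverse (f x) * D f x v * inverse (f x)))) (at x)"
    if "x \<in> S" for x
    by (rule Deriv.has_derivative_inverse[OF assms(3)[OF that] Ck_on_has_derivative[OF Suc.prems that]])
  have "Ck_on k (\<lambda>x. inverse (f x) *\<^sub>R D f x v *\<^sub>R inverse (f x)) S" for v
    by (rule Ck_on_scaleR[OF i Ck_on_scaleR[OF Ck_on_D[OF Suc.prems] i assms(2)] assms(2)])
  from Ck_on_bounded_linear[OF bounded_linear_minus[OF bounded_linear_ident] this assms(2)]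
  have c: "Ck_on k (\<lambda>x. - (inverse (f x) * D f x v * inverse (f x))) S" for v
    by (simp add: mult.assoc)
  show ?case by (rule Ck_on_SucI[OF assms(2) d c])
qed

lemma smooth_on_cong: "smooth_on f S \<Longrightarrow> open S \<Longrightarrow> (\<And>x. x \<in> S \<Longrightarrow> f x = g x) \<Longrightarrow> smooth_on g S"
  unfolding smooth_on_def using Ck_on_cong by blast

lemma smooth_on_subset: "smooth_on f S \<Longrightarrow> T \<subseteq> S \<Longrightarrow> smooth_on f T"
  unfolding smooth_on_def using Ck_on_subset by blast

lemma smooth_on_const: "smooth_on (\<lambda>x. c) S"
  by (simp add: smooth_on_def Ck_on_const)

lemma smooth_on_bounded_linear:
  "bounded_linear l \<Longrightarrow> smooth_on f S \<Longrightarrow> open S \<Longrightarrow> smooth_on (\<lambda>x. l (f x)) S"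
  by (simp add: smooth_on_def Ck_on_bounded_linear)

lemma smooth_on_add:
  "smooth_on f S \<Longrightarrow> smooth_on g S \<Longrightarrow> open S \<Longrightarrow> smooth_on (\<lambda>x. f x + g x) S"
  by (simp add: smooth_on_def Ck_on_add)

lemma smooth_on_scaleR:
  fixes f :: "'a::euclidean_space \<Rightarrow> real"
  shows "smooth_on f S \<Longrightarrow> smooth_on g S \<Longrightarrow> open S \<Longrightarrow> smooth_on (\<lambda>x. f x *\<^sub>R g x) S"
  by (simp add: smooth_on_def Ck_on_scaleR)

lemma smooth_on_mult:
  fixes f g :: "'a::euclidean_space \<Rightarrow> real"
  shows "smooth_on f S \<Longrightarrow> smooth_on g S \<Longrightarrow> open S \<Longrightarrow> smooth_on (\<lambda>x. f x * g x) S"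
  using smooth_on_scaleR[of f S g] by simp

lemma smooth_on_inverse:
  fixes f :: "'a::euclidean_space \<Rightarrow> real"
  shows "smooth_on f S \<Longrightarrow> open S \<Longrightarrow> (\<And>x. x \<in> S \<Longrightarrow> f x \<noteq> 0) \<Longrightarrow> smooth_on (\<lambda>x. inverse (f x)) S"
  by (simp add: smooth_on_def Ck_on_inverse)

lemma smooth_on_uminus: "smooth_on f S \<Longrightarrow> open S \<Longrightarrow> smooth_on (\<lambda>x. - f x) S"
  by (rule smooth_on_bounded_linear[OF bounded_linear_minus[OF bounded_linear_ident]])

lemma smooth_on_diff:
  "smooth_on f S \<Longrightarrow> smooth_on g S \<Longrightarrow> open S \<Longrightarrow> smooth_on (\<lambda>x. f x - g x) S"
  using smooth_on_add[OF _ smooth_on_uminus, of f S g] by simp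

lemma smooth_on_sum:
  assumes "\<And>i. i \<in> I \<Longrightarrow> smooth_on (f i) S" "open S"
  shows "smooth_on (\<lambda>x. \<Sum>i\<in>I. f i x) S"
  using assms(1)
  by (induction I rule: infinite_finite_induct)
     (auto intro!: smooth_on_const smooth_on_add simp: assms(2))

lemma smooth_on_prod:
  fixes f :: "'i \<Rightarrow> 'a::euclidean_space \<Rightarrow> real"
  assumes "\<And>i. i \<in> I \<Longrightarrow> smooth_on (f i) S" "open S"
  shows "smooth_on (\<lambda>x. \<Prod>i\<in>I. f i x) S"
  using assms(1)
  by (induction I rule: infinite_finite_induct)
     (auto intro!: smooth_on_const smooth_on_mult simp: assms(2))

lemma smooth_on_D: "smooth_on f S \<Longrightarrow> smooth_on (\<lambda>x. D f x v) S"
  unfolding smooth_on_def by (metis Ck_on.simps(2))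

lemma smooth_on_differentiable: "smooth_on f S \<Longrightarrow> x \<in> S \<Longrightarrow> f differentiable (at x)"
  unfolding smooth_on_def by (metis Ck_on.simps(2))

lemma smooth_on_continuous: "smooth_on f S \<Longrightarrow> continuous_on S f"
  unfolding smooth_on_def by (metis Ck_on.simps(1))

lemma smooth_on_det:
  fixes A :: "'a::euclidean_space \<Rightarrow> real^'n^'n"
  assumes "\<And>i j. smooth_on (\<lambda>x. A x $ i $ j) S" "open S"
  shows "smooth_on (\<lambda>x. det (A x)) S"
  unfolding det_def
  by (intro smooth_on_sum smooth_on_mult smooth_on_const smooth_on_prod assms)

lemma smooth_on_vec_lambda:
  fixes f :: "'a::euclidean_space \<Rightarrow> real^'n"
  assumes "\<And>i. smooth_on (\<lambda>x. f x $ i) S" "open S"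
  shows "smooth_on f S"
proof -
  have "smooth_on (\<lambda>x. \<Sum>i\<in>UNIV. f x $ i *\<^sub>R axis i (1::real)) S"
    by (intro smooth_on_sum smooth_on_scaleR smooth_on_const assms)
  moreover have "(\<Sum>i\<in>UNIV. f x $ i *\<^sub>R axis i (1::real)) = f x" for x
    by (simp add: vec_eq_iff axis_def if_distrib cong: if_cong)
  ultimately show ?thesis by simp
qed

lemma matrix_inv_cancel:
  fixes A :: "real^'n^'n"
  assumes "invertible A"
  shows "A ** matrix_inv A = mat 1" "matrix_inv A ** A = mat 1"
  using assms someI_ex[of "\<lambda>B. A ** B = mat 1 \<and> B ** A = mat 1"]
  unfolding invertible_def matrix_inv_def by auto

text \<open>
  Cramer's rule writes the solution of a linear system as a quotient of determinants, which are
  polynomials in the entries. This makes the Christoffel symbols smooth.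
\<close>

lemma smooth_on_matrix_inv_mult:
  fixes A :: "'a::euclidean_space \<Rightarrow> real^'n^'n"
  assumes A: "\<And>i j. smooth_on (\<lambda>x. A x $ i $ j) S" and b: "\<And>i. smooth_on (\<lambda>x. b x $ i) S"
    and S: "open S" and inv: "\<And>x. x \<in> S \<Longrightarrow> invertible (A x)"
  shows "smooth_on (\<lambda>x. matrix_inv (A x) *v b x) S"
proof (rule smooth_on_vec_lambda[OF _ S])
  fix k
  define N where "N x = det (\<chi> i j. if j = k then b x $ i else A x $ i $ j)" for x
  have "smooth_on (\<lambda>x. N x * inverse (det (A x))) S"
    unfolding N_def
  proof (intro smooth_on_mult smooth_on_inverse smooth_on_det S)
    show "smooth_on (\<lambda>x. (\<chi> i j. if j = k then b x $ i else A x $ i $ j) $ i $ j) S" for i j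
      using A b by (cases "j = k") auto
    show "det (A x) \<noteq> 0" if "x \<in> S" for x
      using inv[OF that] by (simp add: invertible_det_nz)
  qed (rule A)
  then show "smooth_on (\<lambda>x. (matrix_inv (A x) *v b x) $ k) S"
  proof (rule smooth_on_cong[OF _ S])
    fix x assume x: "x \<in> S"
    have "A x *v (matrix_inv (A x) *v b x) = b x"
      by (simp add: matrix_vector_mul_assoc matrix_inv_cancel inv x)
    then have "matrix_inv (A x) *v b x =
        (\<chi> k. det (\<chi> i j. if j = k then b x $ i else A x $ i $ j) / det (A x))"
      using cramer inv[OF x] invertible_det_nz by blast
    then show "N x * inverse (det (A x)) = (matrix_inv (A x) *v b x) $ k"
      by (simp add: N_def divide_inverse)
  qed
qed

section \<open>Symmetry of second derivatives\<close>

lemma has_real_derivative_along_line: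
  fixes f :: "'a::real_normed_vector \<Rightarrow> real"
  assumes "f differentiable (at (p + t *\<^sub>R v))"
  shows "((\<lambda>t. f (p + t *\<^sub>R v)) has_real_derivative D f (p + t *\<^sub>R v) v) (at t)"
proof -
  have l: "((\<lambda>t. p + t *\<^sub>R v) has_derivative (\<lambda>s. s *\<^sub>R v)) (at t)"
    by (auto intro!: derivative_eq_intros)
  have "((\<lambda>t. f (p + t *\<^sub>R v)) has_derivative (\<lambda>s. D f (p + t *\<^sub>R v) (s *\<^sub>R v))) (at t)"
    using diff_chain_at[OF l has_derivative_D[OF assms]] by (simp add: o_def)
  moreover have "D f (p + t *\<^sub>R v) (s *\<^sub>R v) = D f (p + t *\<^sub>R v) v * s" for s
    using linear_scale[OF linear_frechet_derivative[OF assms]] by (simp add: mult.commute)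
  ultimately show ?thesis by (simp add: has_field_derivative_def)
qed

text \<open>
  The mean value theorem, applied once in direction \<open>u\<close> and once in direction \<open>v\<close>, turns the
  second difference of \<open>f\<close> over a small parallelogram into a mixed second derivative at some point of
  it. The left-hand side is symmetric in \<open>u\<close> and \<open>v\<close>, so both mixed derivatives
  attain the same value, at points arbitrarily close to \<open>x\<close>.
\<close>

lemma second_difference_mvt:
  fixes f :: "'a::euclidean_space \<Rightarrow> real"
  assumes S: "\<And>s t. 0 \<le> s \<Longrightarrow> s \<le> h \<Longrightarrow> 0 \<le> t \<Longrightarrow> t \<le> h \<Longrightarrow> x + s *\<^sub>R u + t *\<^sub>R v \<in> S"
    and f: "Ck_on 2 f S" and h: "0 < h"
  obtains s t where "0 < s" "s < h" "0 < t" "t < h"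
    "f (x + h *\<^sub>R u + h *\<^sub>R v) - f (x + h *\<^sub>R u) - f (x + h *\<^sub>R v) + f x
      = h * h * D (\<lambda>y. D f y u) (x + s *\<^sub>R u + t *\<^sub>R v) v"
proof -
  have f1: "f differentiable (at y)" and f2: "(\<lambda>y. D f y u) differentiable (at y)" if "y \<in> S" for y
    using f that by (auto simp: numeral_2_eq_2)
  define \<psi> where "\<psi> s = f (x + h *\<^sub>R v + s *\<^sub>R u) - f (x + s *\<^sub>R u)" for s
  have "(\<psi> has_real_derivative D f (x + h *\<^sub>R v + s *\<^sub>R u) u - D f (x + s *\<^sub>R u) u) (at s)"
    if "0 \<le> s" "s \<le> h" for s
    unfolding \<psi>_def using S[of s h] S[of s 0] that h
    by (intro derivative_intros has_real_derivative_along_line f1) (auto simp: algebra_simps)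
  then obtain s where s: "0 < s" "s < h" and
    e1: "\<psi> h - \<psi> 0 = (h - 0) * (D f (x + h *\<^sub>R v + s *\<^sub>R u) u - D f (x + s *\<^sub>R u) u)"
    using MVT2[of 0 h \<psi> "\<lambda>s. D f (x + h *\<^sub>R v + s *\<^sub>R u) u - D f (x + s *\<^sub>R u) u"] h by blast
  define \<theta> where "\<theta> t = D f (x + s *\<^sub>R u + t *\<^sub>R v) u" for t
  have "(\<theta> has_real_derivative D (\<lambda>y. D f y u) (x + s *\<^sub>R u + t *\<^sub>R v) v) (at t)"
    if "0 \<le> t" "t \<le> h" for t
    unfolding \<theta>_def using S[of s t] that s
    by (intro has_real_derivative_along_line f2) auto
  then obtain t where t: "0 < t" "t < h" and
    e2: "\<theta> h - \<theta> 0 = (h - 0) * D (\<lambda>y. D f y u) (x + s *\<^sub>R u + t *\<^sub>R v) v"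
    using MVT2[of 0 h \<theta> "\<lambda>t. D (\<lambda>y. D f y u) (x + s *\<^sub>R u + t *\<^sub>R v) v"] h by blast
  have "\<psi> h - \<psi> 0 = h * (\<theta> h - \<theta> 0)"
    using e1 by (simp add: \<theta>_def algebra_simps)
  then have "\<psi> h - \<psi> 0 = h * h * D (\<lambda>y. D f y u) (x + s *\<^sub>R u + t *\<^sub>R v) v"
    using e2 by simp
  then show ?thesis using s t by (intro that[of s t]) (auto simp: \<psi>_def algebra_simps)
qed

lemma D_D_commute_real:
  fixes f :: "'a::euclidean_space \<Rightarrow> real"
  assumes f: "Ck_on 2 f S" and S: "open S" and x: "x \<in> S"
  shows "D (\<lambda>y. D f y u) x v = D (\<lambda>y. D f y v) x u"
proof (rule ccontr)
  define A where "A y = D (\<lambda>y. D f y u) y v" for y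
  define B where "B y = D (\<lambda>y. D f y v) y u" for y
  assume "\<not> ?thesis"
  then have ne: "\<bar>A x - B x\<bar> / 2 > 0" (is "?e > 0") by (simp add: A_def B_def)
  have "continuous_on S A" "continuous_on S B"
    using f by (auto simp: numeral_2_eq_2 A_def B_def)
  then have "isCont A x" "isCont B x"
    using S x by (auto simp: continuous_on_eq_continuous_at)
  then obtain d1 d2 where d1: "d1 > 0" "\<And>y. dist y x < d1 \<Longrightarrow> dist (A y) (A x) < ?e"
    and d2: "d2 > 0" "\<And>y. dist y x < d2 \<Longrightarrow> dist (B y) (B x) < ?e"
    using ne unfolding continuous_at_eps_delta dist_norm by metis
  obtain d3 where d3: "d3 > 0" "ball x d3 \<subseteq> S" using S x openE by blast
  define d where "d = min d1 (min d2 d3)"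
  have d: "d > 0" using d1 d2 d3 by (simp add: d_def)
  \<comment> \<open>small enough that the parallelogram at \<open>x\<close> with sides \<open>h u\<close> and \<open>h v\<close> stays within distance \<open>d\<close> of \<open>x\<close>\<close>
  define h where "h = d / (2 * (norm u + norm v + 1))"
  have h: "h > 0" using d by (auto simp: h_def intro!: divide_pos_pos add_nonneg_pos)
  have near: "dist (x + s *\<^sub>R u + t *\<^sub>R v) x < d" if "0 \<le> s" "s \<le> h" "0 \<le> t" "t \<le> h" for s t
  proof -
    have "dist (x + s *\<^sub>R u + t *\<^sub>R v) x = norm (s *\<^sub>R u + t *\<^sub>R v)"
      by (simp add: dist_norm)
    also have "\<dots> \<le> s * norm u + t * norm v"
      using that by (metis abs_of_nonneg norm_scaleR norm_triangle_ineq)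
    also have "\<dots> \<le> h * norm u + h * norm v"
      using that by (intro add_mono mult_right_mono) auto
    also have "\<dots> \<le> h * (norm u + norm v + 1)" using h by (simp add: algebra_simps)
    also have "\<dots> = d / 2"
    proof -
      have "norm u + norm v + 1 \<noteq> 0" by (smt (verit) norm_ge_zero)
      then show ?thesis by (simp add: h_def divide_simps)
    qed
    finally show ?thesis using d by simp
  qed
  have inS: "x + s *\<^sub>R u + t *\<^sub>R v \<in> S" if "0 \<le> s" "s \<le> h" "0 \<le> t" "t \<le> h" for s t
    using near[OF that] d3(2) by (auto simp: d_def dist_commute subset_iff)
  have inS': "x + s *\<^sub>R v + t *\<^sub>R u \<in> S" if "0 \<le> s" "s \<le> h" "0 \<le> t" "t \<le> h" for s t
    using inS[of t s] that by (simp add: algebra_simps)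
  obtain s t where st: "0 < s" "s < h" "0 < t" "t < h" and
    E1: "f (x + h *\<^sub>R u + h *\<^sub>R v) - f (x + h *\<^sub>R u) - f (x + h *\<^sub>R v) + f x
      = h * h * A (x + s *\<^sub>R u + t *\<^sub>R v)"
    using second_difference_mvt[OF inS f h] unfolding A_def by blast
  obtain s' t' where st': "0 < s'" "s' < h" "0 < t'" "t' < h" and
    E2: "f (x + h *\<^sub>R v + h *\<^sub>R u) - f (x + h *\<^sub>R v) - f (x + h *\<^sub>R u) + f x
      = h * h * B (x + s' *\<^sub>R v + t' *\<^sub>R u)"
    using second_difference_mvt[OF inS' f h] unfolding B_def by blast
  have "h * h * A (x + s *\<^sub>R u + t *\<^sub>R v) = h * h * B (x + t' *\<^sub>R u + s' *\<^sub>R v)"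
    using E1 E2 by (simp add: algebra_simps)
  then have "A (x + s *\<^sub>R u + t *\<^sub>R v) = B (x + t' *\<^sub>R u + s' *\<^sub>R v)" using h by simp
  moreover have "dist (A (x + s *\<^sub>R u + t *\<^sub>R v)) (A x) < ?e"
    using near[of s t] st by (intro d1) (auto simp: d_def)
  moreover have "dist (B (x + t' *\<^sub>R u + s' *\<^sub>R v)) (B x) < ?e"
    using near[of t' s'] st' by (intro d2) (auto simp: d_def)
  ultimately show False by (simp add: dist_real_def) argo
qed

lemma D_D_commute:
  fixes f :: "'a::euclidean_space \<Rightarrow> 'b::euclidean_space"
  assumes f: "smooth_on f S" and S: "open S" and x: "x \<in> S"
  shows "D (\<lambda>y. D f y u) x v = D (\<lambda>y. D f y v) x u"
proof (rule euclidean_eqI)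
  fix b :: 'b
  have D1: "D (\<lambda>y. g y \<bullet> b) y w = D g y w \<bullet> b" if "smooth_on g S" "y \<in> S" for g :: "'a \<Rightarrow> 'b" and y w
    using smooth_on_differentiable[OF that]
    by (intro D_eq) (auto intro!: has_derivative_inner_left has_derivative_D)
  have D2: "D (\<lambda>y. D f y u) x v \<bullet> b = D (\<lambda>y. D (\<lambda>y. f y \<bullet> b) y u) x v" for u v
  proof -
    have "D (\<lambda>y. D f y u) x v \<bullet> b = D (\<lambda>y. D f y u \<bullet> b) x v"
      using D1[OF smooth_on_D[OF f] x] by simp
    also have "\<dots> = D (\<lambda>y. D (\<lambda>y. f y \<bullet> b) y u) x v"
      by (rule D_cong_open[OF S x]) (simp add: D1[OF f])
    finally show ?thesis .
  qed
  have "smooth_on (\<lambda>y. f y \<bullet> b) S"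
    by (rule smooth_on_bounded_linear[OF bounded_linear_inner_left f S])
  then show "D (\<lambda>y. D f y u) x v \<bullet> b = D (\<lambda>y. D f y v) x u \<bullet> b"
    unfolding D2 by (intro D_D_commute_real[OF _ S x]) (simp add: smooth_on_def)
qed

section \<open>Derivatives of families of linear and bilinear maps\<close>

lemma vec_expand: "(x::real^'n) = (\<Sum>i\<in>UNIV. x $ i *\<^sub>R axis i 1)"
  by (simp add: vec_eq_iff axis_def if_distrib cong: if_cong)

lemma linear_expand: "linear f \<Longrightarrow> f (x::real^'n) = (\<Sum>i\<in>UNIV. x $ i *\<^sub>R f (axis i 1))"
  using vec_expand[of x] linear_sum[of f] linear_scale[of f] by (metis (no_types, lifting) sum.cong)

text \<open>
  The Leibniz rule for a linear map and its argument, both depending on the point: expanded in a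
  basis, it is the product rule for the coordinates of \<open>U\<close>.
\<close>

lemma has_derivative_linear_family:
  fixes P :: "'c::real_normed_vector \<Rightarrow> 'a::euclidean_space \<Rightarrow> 'b::real_normed_vector"
  assumes V: "open V" "x \<in> V" and lin: "\<And>y. y \<in> V \<Longrightarrow> linear (P y)"
    and P: "\<And>u. (\<lambda>y. P y u) differentiable (at x)" and U: "(U has_derivative U') (at x)"
  shows "((\<lambda>y. P y (U y)) has_derivative (\<lambda>a. D (\<lambda>y. P y (U x)) x a + P x (U' a))) (at x)"
proof -
  have expand: "(\<Sum>b\<in>Basis. (w \<bullet> b) *\<^sub>R P y b) = P y w" if "y \<in> V" for y w
  proof -
    have "P y w = P y (\<Sum>b\<in>Basis. (w \<bullet> b) *\<^sub>R b)" by (simp add: euclidean_representation)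
    also have "\<dots> = (\<Sum>b\<in>Basis. (w \<bullet> b) *\<^sub>R P y b)"
      by (simp only: linear_sum[OF lin[OF that]] linear_scale[OF lin[OF that]])
    finally show ?thesis by simp
  qed
  have main: "((\<lambda>y. P y (W y)) has_derivative
      (\<lambda>a. \<Sum>b\<in>Basis. (W x \<bullet> b) *\<^sub>R D (\<lambda>y. P y b) x a + (W' a \<bullet> b) *\<^sub>R P x b)) (at x)"
    if "(W has_derivative W') (at x)" for W W'
  proof (rule has_derivative_cong_open[OF _ V])
    show "((\<lambda>y. \<Sum>b\<in>Basis. (W y \<bullet> b) *\<^sub>R P y b) has_derivative
        (\<lambda>a. \<Sum>b\<in>Basis. (W x \<bullet> b) *\<^sub>R D (\<lambda>y. P y b) x a + (W' a \<bullet> b) *\<^sub>R P x b)) (at x)"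
    proof (rule has_derivative_sum)
      fix b :: 'a
      have "((\<lambda>y. P y b) has_derivative D (\<lambda>y. P y b) x) (at x)"
        by (rule has_derivative_D[OF P])
      from has_derivative_scaleR[OF has_derivative_inner_left[OF that] this]
      show "((\<lambda>y. (W y \<bullet> b) *\<^sub>R P y b) has_derivative
        (\<lambda>a. (W x \<bullet> b) *\<^sub>R D (\<lambda>y. P y b) x a + (W' a \<bullet> b) *\<^sub>R P x b)) (at x)" .
    qed
  qed (rule expand)
  have "D (\<lambda>y. P y (U x)) x a = (\<Sum>b\<in>Basis. (U x \<bullet> b) *\<^sub>R D (\<lambda>y. P y b) x a)" for a
    by (rule trans[OF D_eq[OF main[of "\<lambda>y. U x" "\<lambda>a. 0", OF has_derivative_const]]]) simp
  then show ?thesis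
    using main[OF U] by (simp add: sum.distrib expand[OF V(2)])
qed

lemma has_derivative_bilinear_family:
  fixes B :: "'c::real_normed_vector \<Rightarrow> 'a::euclidean_space \<Rightarrow> 'a \<Rightarrow> 'b::real_normed_vector"
  assumes V: "open V" "x \<in> V" and bil: "\<And>y. y \<in> V \<Longrightarrow> bilinear (B y)"
    and B: "\<And>u v. (\<lambda>y. B y u v) differentiable (at x)"
    and U: "(U has_derivative U') (at x)" and W: "(W has_derivative W') (at x)"
  shows "((\<lambda>y. B y (U y) (W y)) has_derivative
    (\<lambda>a. D (\<lambda>y. B y (U x) (W x)) x a + B x (U' a) (W x) + B x (U x) (W' a))) (at x)"
proof -
  have l: "linear (\<lambda>u. B y u w)" "linear (B y w)" if "y \<in> V" for y w
    using bil[OF that] by (auto simp: bilinear_def)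
  have 1: "((\<lambda>y. B y (U y) w) has_derivative (\<lambda>a. D (\<lambda>y. B y (U x) w) x a + B x (U' a) w)) (at x)" for w
    by (rule has_derivative_linear_family[OF V l(1) B U])
  have "((\<lambda>y. B y (U y) (W y)) has_derivative
    (\<lambda>a. D (\<lambda>y. B y (U y) (W x)) x a + B x (U x) (W' a))) (at x)"
    by (rule has_derivative_linear_family[OF V l(2) _ W]) (use 1 in \<open>auto simp: differentiable_def\<close>)
  then show ?thesis by (simp add: D_eq[OF 1])
qed

lemma linear_D_family:
  assumes V: "open V" "x \<in> V" and lin: "\<And>y. y \<in> V \<Longrightarrow> linear (P y)"
    and P: "\<And>u. (\<lambda>y. P y u) differentiable (at x)"
  shows "linear (\<lambda>u. D (\<lambda>y. P y u) x a)"
proof (rule linearI)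
  have d: "((\<lambda>y. P y u) has_derivative D (\<lambda>y. P y u) x) (at x)" for u
    by (rule has_derivative_D[OF P])
  fix u v and r :: real
  have "D (\<lambda>y. P y (u + v)) x a = D (\<lambda>y. P y u + P y v) x a"
    by (rule D_cong_open[OF V]) (simp add: linear_add[OF lin])
  then show "D (\<lambda>y. P y (u + v)) x a = D (\<lambda>y. P y u) x a + D (\<lambda>y. P y v) x a"
    by (simp only: D_eq[OF has_derivative_add[OF d d]])
  have "D (\<lambda>y. P y (r *\<^sub>R u)) x a = D (\<lambda>y. r *\<^sub>R P y u) x a"
    by (rule D_cong_open[OF V]) (simp add: linear_scale[OF lin])
  then show "D (\<lambda>y. P y (r *\<^sub>R u)) x a = r *\<^sub>R D (\<lambda>y. P y u) x a"
    by (simp only: D_eq[OF has_derivative_scaleR_right[OF d]])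
qed

lemma smooth_on_linear_family:
  fixes P :: "'a::euclidean_space \<Rightarrow> real^'n \<Rightarrow> 'b::real_normed_vector"
  assumes V: "open V" and lin: "\<And>y. y \<in> V \<Longrightarrow> linear (P y)"
    and P: "\<And>u. smooth_on (\<lambda>y. P y u) V" and U: "smooth_on U V"
  shows "smooth_on (\<lambda>y. P y (U y)) V"
proof (rule smooth_on_cong[OF _ V])
  show "smooth_on (\<lambda>y. \<Sum>i\<in>UNIV. U y $ i *\<^sub>R P y (axis i 1)) V"
    by (rule smooth_on_sum[OF smooth_on_scaleR[OF
          smooth_on_bounded_linear[OF bounded_linear_vec_nth U V] P V] V])
  show "(\<Sum>i\<in>UNIV. U y $ i *\<^sub>R P y (axis i 1)) = P y (U y)" if "y \<in> V" for y
    by (rule linear_expand[OF lin[OF that], symmetric])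
qed

lemma has_derivative_chain:
  assumes "(\<phi> has_derivative \<phi>') (at x)" "f differentiable (at (\<phi> x))"
  shows "((\<lambda>y. f (\<phi> y)) has_derivative (\<lambda>a. D f (\<phi> x) (\<phi>' a))) (at x)"
  using diff_chain_at[OF assms(1) has_derivative_D[OF assms(2)]] by (simp add: o_def)

section \<open>Traces and dual bases\<close>

definition tr :: "(real^'n \<Rightarrow> real^'n) \<Rightarrow> real" where
  "tr f = (\<Sum>i\<in>UNIV. f (axis i 1) $ i)"

lemma tr_eq_trace: "tr f = trace (matrix f)"
  by (simp add: tr_def trace_def matrix_def)

lemma tr_commute:
  assumes "linear f" "linear g"
  shows "tr (\<lambda>x. f (g x)) = tr (\<lambda>x. g (f x))"
proof -
  have "matrix (\<lambda>x. f (g x)) = matrix f ** matrix g" "matrix (\<lambda>x. g (f x)) = matrix g ** matrix f"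
    using matrix_compose[OF assms(2,1)] matrix_compose[OF assms] by (simp_all add: o_def)
  then show ?thesis using trace_mul_sym[of "matrix f" "matrix g"] by (simp add: tr_eq_trace)
qed

lemma tr_add: "tr (\<lambda>x. f x + g x) = tr f + tr g"
  by (simp add: tr_def sum.distrib)

lemma tr_diff: "tr (\<lambda>x. f x - g x) = tr f - tr g"
  by (simp add: tr_def sum_subtractf)

definition gram :: "(real^'n \<Rightarrow> real^'n \<Rightarrow> real) \<Rightarrow> real^'n^'n" where
  "gram g = (\<chi> i j. g (axis i 1) (axis j 1))"

lemma gram_mult:
  assumes "bilinear g"
  shows "(gram g *v x) $ i = g (axis i 1) x"
proof -
  have "linear (g (axis i 1))" using assms by (simp add: bilinear_def)
  from linear_expand[OF this, of x] show ?thesis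
    by (simp add: gram_def matrix_vector_mult_def mult.commute)
qed

definition nondegenerate :: "(real^'n \<Rightarrow> real^'n \<Rightarrow> real) \<Rightarrow> bool" where
  "nondegenerate g \<longleftrightarrow> (\<forall>v. (\<forall>w. g v w = 0) \<longrightarrow> v = 0)"

lemma invertible_gram_iff:
  assumes b: "bilinear g" and sym: "\<And>u v. g u v = g v u"
  shows "invertible (gram g) \<longleftrightarrow> nondegenerate g"
proof -
  have z: "gram g *v v = 0 \<longleftrightarrow> (\<forall>w. g v w = 0)" for v
  proof
    assume 0: "gram g *v v = 0"
    have "g w v = 0" for w
    proof -
      have "linear (\<lambda>w. g w v)" using b by (simp add: bilinear_def)
      then show ?thesis
        using linear_expand[of "\<lambda>w. g w v" w] 0 gram_mult[OF b, of v] by simp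
    qed
    then show "\<forall>w. g v w = 0" using sym by metis
  next
    assume "\<forall>w. g v w = 0"
    then have "g w v = 0" for w using sym by metis
    then show "gram g *v v = 0" using gram_mult[OF b, of v] by (simp add: vec_eq_iff)
  qed
  show ?thesis
    unfolding invertible_left_inverse matrix_left_invertible_ker nondegenerate_def z ..
qed

text \<open>
  The vectors \<open>f i\<close> represent the coordinate functionals by means of \<open>g\<close>. Contractions with the
  inverse metric become sums over \<open>axis i 1\<close> paired with \<open>f i\<close>. This pair
  takes the place of an orthonormal basis and works in every signature.
\<close>

lemma dual_basis:
  fixes g :: "real^'n \<Rightarrow> real^'n \<Rightarrow> real"
  assumes b: "bilinear g" and sym: "\<And>u v. g u v = g v u" and nd: "nondegenerate g"
  obtains f where "\<And>x i. g x (f i) = x $ i"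
    and "\<And>x. x = (\<Sum>i\<in>UNIV. g x (axis i 1) *\<^sub>R f i)"
proof -
  have inv: "invertible (gram g)" using invertible_gram_iff[OF b sym] nd by blast
  define f where "f i = matrix_inv (gram g) *v axis i 1" for i
  have "gram g *v f i = axis i 1" for i
    by (simp add: f_def matrix_vector_mul_assoc matrix_inv_cancel(1)[OF inv])
  then have 1: "g (axis k 1) (f i) = (axis i 1 :: real^'n) $ k" for i k
    using gram_mult[OF b, of "f i" k] by simp
  have f1: "g x (f i) = x $ i" for x i
  proof -
    have "linear (\<lambda>x. g x (f i))" using b by (simp add: bilinear_def)
    from linear_expand[OF this, of x] have "g x (f i) = (\<Sum>k\<in>UNIV. x $ k * (axis i 1 :: real^'n) $ k)"
      by (simp add: 1)
    then show ?thesis by (simp add: axis_def if_distrib cong: if_cong)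
  qed
  have "x = (\<Sum>i\<in>UNIV. g x (axis i 1) *\<^sub>R f i)" for x
  proof -
    have l: "linear (g w)" "linear (\<lambda>x. g x w)" for w
      using b by (auto simp: bilinear_def)
    have "g (x - (\<Sum>i\<in>UNIV. g x (axis i 1) *\<^sub>R f i)) w = 0" for w
    proof -
      have "g (\<Sum>i\<in>UNIV. g x (axis i 1) *\<^sub>R f i) w = (\<Sum>i\<in>UNIV. g x (axis i 1) * g (f i) w)"
        by (simp add: linear_sum[OF l(2)] linear_scale[OF l(2)])
      also have "\<dots> = (\<Sum>i\<in>UNIV. w $ i *\<^sub>R g x (axis i 1))"
        by (intro sum.cong refl) (simp add: sym[of _ w] f1 mult.commute)
      also have "\<dots> = g x w" using linear_expand[OF l(1), of x w] by simp
      finally show ?thesis by (simp add: linear_diff[OF l(2)])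
    qed
    then have "x - (\<Sum>i\<in>UNIV. g x (axis i 1) *\<^sub>R f i) = 0"
      using nd unfolding nondegenerate_def by blast
    then show ?thesis by simp
  qed
  with f1 show ?thesis by (rule that)
qed

text \<open>
  That the two bases may be exchanged in a trace is the symmetry of the inverse metric.
\<close>

lemma tr_dual_basis:
  fixes g :: "real^'n \<Rightarrow> real^'n \<Rightarrow> real"
  assumes b: "bilinear g" and f1: "\<And>x i. g x (f i) = x $ i"
    and f2: "\<And>x. x = (\<Sum>i\<in>UNIV. g x (axis i 1) *\<^sub>R f i)"
    and sym: "\<And>u v. g u v = g v u"
    and B: "linear B"
  shows "tr B = (\<Sum>i\<in>UNIV. g (B (axis i 1)) (f i))" and "tr B = (\<Sum>i\<in>UNIV. g (B (f i)) (axis i 1))"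
proof -
  show "tr B = (\<Sum>i\<in>UNIV. g (B (axis i 1)) (f i))" by (simp add: f1 tr_def)
  let ?e = "\<lambda>i. axis i 1 :: real^'n"
  have Be: "B (?e i) $ k = (\<Sum>j\<in>UNIV. g (?e i) (?e j) * B (f j) $ k)" for i k
  proof -
    have "B (?e i) = B (\<Sum>j\<in>UNIV. g (?e i) (?e j) *\<^sub>R f j)"
      by (rule arg_cong[OF f2])
    also have "\<dots> = (\<Sum>j\<in>UNIV. g (?e i) (?e j) *\<^sub>R B (f j))"
      by (simp only: linear_sum[OF B] linear_scale[OF B])
    finally show ?thesis by simp
  qed
  have fe: "g x (?e j) = (\<Sum>i\<in>UNIV. g (?e j) (?e i) * x $ i)" for x j
  proof -
    have l: "linear (g (?e j))" using b by (simp add: bilinear_def)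
    have "g x (?e j) = g (?e j) x" by (rule sym)
    also have "\<dots> = (\<Sum>i\<in>UNIV. x $ i *\<^sub>R g (?e j) (?e i))" by (rule linear_expand[OF l])
    finally show ?thesis by (simp add: mult.commute)
  qed
  have "tr B = (\<Sum>i\<in>UNIV. \<Sum>j\<in>UNIV. g (?e i) (?e j) * B (f j) $ i)"
    by (simp add: tr_def Be)
  also have "\<dots> = (\<Sum>j\<in>UNIV. \<Sum>i\<in>UNIV. g (?e j) (?e i) * B (f j) $ i)"
    by (subst sum.swap) (simp add: sym)
  also have "\<dots> = (\<Sum>j\<in>UNIV. g (B (f j)) (?e j))"
    by (simp only: fe[of "B (f _)"])
  finally show "tr B = (\<Sum>i\<in>UNIV. g (B (f i)) (axis i 1))" .
qed

section \<open>Algebraic curvature tensors\<close>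

text \<open>
  The pointwise symmetries shared by the Riemann tensor and its covariant derivative in any fixed
  direction.
\<close>

locale algebraic_curvature =
  fixes g :: "real^'n \<Rightarrow> real^'n \<Rightarrow> real" and K :: "real^'n \<Rightarrow> real^'n \<Rightarrow> real^'n \<Rightarrow> real^'n"
  assumes g_bilinear: "bilinear g" and g_sym: "g u v = g v u" and g_nondeg: "nondegenerate g"
    and K_linear: "linear (\<lambda>u. K u v w)"
    and K_antisym: "K u v w = - K v u w"
    and K_cyclic: "K u v w + K v w u + K w u v = 0"
    and K_skew: "g (K u v w) z = - g (K u v z) w"
begin

text \<open>
  The cyclic identity for each of the four choices of the argument that stays fixed gives four relations
  between six numbers, once antisymmetry and skewness have been used to identify terms; a signed sum of
  the four is twice the claim.
\<close>

lemma pair_symmetry: "g (K u v w) z = g (K w z u) v"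
proof -
  have cyc: "g (K u v w) z + g (K v w u) z + g (K w u v) z = 0" for u v w z
    using arg_cong[OF K_cyclic[of u v w], of "\<lambda>x. g x z"]
    by (simp add: bilinear_ladd[OF g_bilinear] bilinear_lzero[OF g_bilinear])
  have anti: "g (K u v w) z = - g (K v u w) z" for u v w z
    using K_antisym[of u v w] by (simp add: bilinear_lneg[OF g_bilinear])
  have "g (K u v w) z + g (K v w u) z + g (K w u v) z = 0" by (rule cyc)
  moreover have "g (K v w u) z + g (K w z u) v + g (K v z w) u = 0"
    using cyc[of v w z u] K_skew[of v w z u] K_skew[of w z v u] anti[of z v w u] by simp
  moreover have "g (K w z u) v + g (K u z v) w + g (K w u v) z = 0"
    using cyc[of w z u v] anti[of z u w v] K_skew[of u z w v] anti[of u w z v] K_skew[of w u z v] by simp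
  moreover have "g (K u z v) w + g (K u v w) z + g (K v z w) u = 0"
    using cyc[of z u v w] anti[of z u v w] K_skew[of u v z w] K_skew[of v z u w] by simp
  ultimately show ?thesis by argo
qed

lemma ricci_sym: "tr (\<lambda>u. K u v w) = tr (\<lambda>u. K u w v)"
proof -
  obtain f where f1: "\<And>x i. g x (f i) = x $ i"
    and f2: "\<And>x. x = (\<Sum>i\<in>UNIV. g x (axis i 1) *\<^sub>R f i)"
    using dual_basis[OF g_bilinear g_sym g_nondeg] by blast
  note t = tr_dual_basis[OF g_bilinear f1 f2 g_sym K_linear]
  have "tr (\<lambda>u. K u v w) = (\<Sum>i\<in>UNIV. g (K (axis i 1) v w) (f i))" by (rule t(1))
  also have "\<dots> = (\<Sum>i\<in>UNIV. g (K (f i) w v) (axis i 1))"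
  proof (rule sum.cong[OF refl])
    fix i
    have "g (K (axis i 1) v w) (f i) = g (K w (f i) (axis i 1)) v" by (rule pair_symmetry)
    also have "\<dots> = - g (K w (f i) v) (axis i 1)" by (rule K_skew)
    also have "\<dots> = g (K (f i) w v) (axis i 1)"
      using K_antisym[of w "f i" v] by (simp add: bilinear_lneg[OF g_bilinear])
    finally show "g (K (axis i 1) v w) (f i) = g (K (f i) w v) (axis i 1)" .
  qed
  also have "\<dots> = tr (\<lambda>u. K u w v)" by (rule t(2)[symmetric])
  finally show ?thesis .
qed

end

text \<open>
  Here \<open>K a\<close> stands for the covariant derivative of the curvature in direction \<open>a\<close>, and \<open>\<theta>\<close> for \<open>d\<rho>\<close>.
  Contracting the second Bianchi identity once gives \<open>contract1\<close>. Contracting it again in \<open>v, w\<close>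
  yields \<open>n \<theta>(a) + X - \<theta>(a) = 0\<close>, where \<open>X\<close> is a divergence of the curvature; pair symmetry turns \<open>X\<close> into a
  divergence of the Ricci tensor, that is into \<open>-\<theta>(a)\<close> (\<open>contract2\<close>). Hence \<open>(n - 2) \<theta>(a) = 0\<close>.
\<close>

lemma schur_pointwise:
  fixes K :: "real^'n \<Rightarrow> real^'n \<Rightarrow> real^'n \<Rightarrow> real^'n \<Rightarrow> real^'n"
  assumes K: "\<And>a. algebraic_curvature g (K a)"
    and bianchi: "\<And>a u v w. K a u v w + K u v a w + K v a u w = 0"
    and einstein: "\<And>a v w. tr (\<lambda>u. K a u v w) = \<theta> a * g v w"
    and \<theta>: "linear \<theta>" and n: "CARD('n) \<ge> 3"
  shows "\<theta> a = 0"
proof -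
  interpret K: algebraic_curvature g "K a" for a by (rule K)
  note gb = K.g_bilinear
  obtain f where f1: "\<And>x i. g x (f i) = x $ i"
    and f2: "\<And>x. x = (\<Sum>i\<in>UNIV. g x (axis i 1) *\<^sub>R f i)"
    using dual_basis[OF gb K.g_sym K.g_nondeg] by blast
  note t = tr_dual_basis[OF gb f1 f2 K.g_sym K.K_linear]
  let ?e = "\<lambda>i. axis i 1 :: real^'n"
  have contract1: "\<theta> a * g v w + (\<Sum>i\<in>UNIV. g (K (?e i) v a w) (f i)) - \<theta> v * g a w = 0" for v w
  proof -
    have "g (K a (?e i) v w) (f i) + g (K (?e i) v a w) (f i) - g (K v (?e i) a w) (f i) = 0" for i
    proof -
      have "K a (?e i) v w + K (?e i) v a w - K v (?e i) a w = 0"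
        using bianchi[of a "?e i" v w] K.K_antisym[of v a "?e i" w] by simp
      from arg_cong[OF this, of "\<lambda>x. g x (f i)"] show ?thesis
        by (simp add: bilinear_ladd[OF gb] bilinear_lsub[OF gb] bilinear_lzero[OF gb])
    qed
    then have "(\<Sum>i\<in>UNIV. g (K a (?e i) v w) (f i) + g (K (?e i) v a w) (f i) - g (K v (?e i) a w) (f i)) = 0"
      by simp
    then show ?thesis
      using t(1)[of a v w] t(1)[of v a w] einstein[of a v w] einstein[of v a w]
      by (simp add: sum.distrib sum_subtractf)
  qed
  have \<theta>_sum: "(\<Sum>j\<in>UNIV. \<theta> (?e j) * g a (f j)) = \<theta> a"
    using linear_expand[OF \<theta>, of a] by (simp add: f1 mult.commute)
  have contract2: "(\<Sum>j\<in>UNIV. g (K (?e i) (?e j) a (f j)) (f i)) = - (\<theta> (?e i) * g a (f i))" for i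
  proof -
    have "g (K (?e i) (?e j) a (f j)) (f i) = - g (K (?e i) (f j) (f i) a) (?e j)" for j
      using K.pair_symmetry[of "?e i" "?e j" a "f j" "f i"] K.K_skew[of "?e i" "f j" "f i" "?e j" a]
      by simp
    then have "(\<Sum>j\<in>UNIV. g (K (?e i) (?e j) a (f j)) (f i)) = - tr (\<lambda>u. K (?e i) u (f i) a)"
      by (simp add: t(2) sum_negf)
    then show ?thesis by (simp add: einstein K.g_sym[of "f i"])
  qed
  have "0 = (\<Sum>j\<in>UNIV. \<theta> a * g (?e j) (f j) + (\<Sum>i\<in>UNIV. g (K (?e i) (?e j) a (f j)) (f i))
      - \<theta> (?e j) * g a (f j))"
    using contract1 by simp
  also have "\<dots> = \<theta> a * CARD('n) + (\<Sum>j\<in>UNIV. \<Sum>i\<in>UNIV. g (K (?e i) (?e j) a (f j)) (f i)) - \<theta> a"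
    using \<theta>_sum by (simp add: sum.distrib sum_subtractf) (simp add: f1)
  also have "(\<Sum>j\<in>UNIV. \<Sum>i\<in>UNIV. g (K (?e i) (?e j) a (f j)) (f i)) = - \<theta> a"
    by (subst sum.swap) (simp only: contract2 sum_negf \<theta>_sum)
  finally have "\<theta> a * (real CARD('n) - 2) = 0" by (simp add: algebra_simps)
  moreover have "real CARD('n) - 2 \<noteq> 0" using n by simp
  ultimately show "\<theta> a = 0" by (metis mult_eq_0_iff)
qed

text \<open>
  The second difference of the quadratic form at a point of \<open>Y\<close> in direction \<open>u\<close> is a multiple of its value
  at \<open>u\<close>, so that value is zero; polarisation does the rest.
\<close>

lemma quadratic_form_zero_on_open:
  fixes B :: "real^'n \<Rightarrow> real^'n \<Rightarrow> real"
  assumes b: "bilinear B" and sym: "\<And>u v. B u v = B v u"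
    and Y: "open Y" "y \<in> Y" and zero: "\<And>y. y \<in> Y \<Longrightarrow> B y y = 0"
  shows "B u v = 0"
proof -
  have diag: "B u u = 0" for u
  proof -
    obtain e where e: "e > 0" "ball y e \<subseteq> Y" using Y openE by blast
    \<comment> \<open>\<open>y + t u\<close> and \<open>y - t u\<close> lie in the ball of radius \<open>e\<close> around \<open>y\<close>\<close>
    define t where "t = e / (2 * (norm u + 1))"
    have t: "t > 0" using e by (auto simp: t_def intro!: divide_pos_pos add_nonneg_pos)
    have "t * norm u \<le> t * (norm u + 1)" using t by (simp add: algebra_simps)
    also have "\<dots> = e / 2"
    proof -
      have "norm u + 1 \<noteq> 0" by (smt (verit) norm_ge_zero)
      then show ?thesis by (simp add: t_def divide_simps)
    qed
    finally have "y + t *\<^sub>R u \<in> Y" "y - t *\<^sub>R u \<in> Y"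
      using t e by (auto simp: dist_norm subset_iff)
    then have "B (y + t *\<^sub>R u) (y + t *\<^sub>R u) = 0" "B (y - t *\<^sub>R u) (y - t *\<^sub>R u) = 0" "B y y = 0"
      using zero Y by auto
    moreover have "B (y + t *\<^sub>R u) (y + t *\<^sub>R u) + B (y - t *\<^sub>R u) (y - t *\<^sub>R u)
        = 2 * B y y + 2 * (t * t * B u u)"
      by (simp add: bilinear_ladd[OF b] bilinear_radd[OF b] bilinear_lsub[OF b] bilinear_rsub[OF b]
          bilinear_lmul[OF b] bilinear_rmul[OF b] algebra_simps)
    ultimately have "t * t * B u u = 0" by simp
    then show ?thesis using t by simp
  qed
  show ?thesis
    using diag[of "u + v"] diag[of u] diag[of v] sym[of u v]
    by (simp add: bilinear_ladd[OF b] bilinear_radd[OF b])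
qed

section \<open>Curvature of a pseudo-Riemannian metric on an open set\<close>

text \<open>
  The vector is the right-hand side of Koszul's formula, tested against the standard basis, so that
  multiplication with the inverse Gram matrix solves that formula for \<open>\<Gamma>\<close>.
\<close>

definition christoffel ::
    "(real^'n \<Rightarrow> real^'n \<Rightarrow> real^'n \<Rightarrow> real) \<Rightarrow> real^'n \<Rightarrow> real^'n \<Rightarrow> real^'n \<Rightarrow> real^'n" where
  "christoffel g x u v = matrix_inv (gram (g x)) *v
     (\<chi> k. (D (\<lambda>y. g y v (axis k 1)) x u + D (\<lambda>y. g y u (axis k 1)) x v - D (\<lambda>y. g y u v) x (axis k 1)) / 2)"

text \<open>
  In the usual notation this is \<open>R(u,v)w = \<nabla>\<^sub>u\<nabla>\<^sub>v w - \<nabla>\<^sub>v\<nabla>\<^sub>u w\<close> for constant vector fields \<open>u, v, w\<close>.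
\<close>

definition curvature ::
    "(real^'n \<Rightarrow> real^'n \<Rightarrow> real^'n \<Rightarrow> real) \<Rightarrow> real^'n \<Rightarrow> real^'n \<Rightarrow> real^'n \<Rightarrow> real^'n \<Rightarrow> real^'n" where
  "curvature g x u v w =
     D (\<lambda>y. christoffel g y v w) x u - D (\<lambda>y. christoffel g y u w) x v
     + christoffel g x u (christoffel g x v w) - christoffel g x v (christoffel g x u w)"

definition ricci ::
    "(real^'n \<Rightarrow> real^'n \<Rightarrow> real^'n \<Rightarrow> real) \<Rightarrow> real^'n \<Rightarrow> real^'n \<Rightarrow> real^'n \<Rightarrow> real" where
  "ricci g x v w = tr (\<lambda>u. curvature g x u v w)"

locale local_metric =
  fixes V :: "(real^'n) set" and g :: "real^'n \<Rightarrow> real^'n \<Rightarrow> real^'n \<Rightarrow> real"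
  assumes V_open: "open V"
    and g_bilinear: "x \<in> V \<Longrightarrow> bilinear (g x)"
    and g_sym: "x \<in> V \<Longrightarrow> g x u v = g x v u"
    and g_nondeg: "x \<in> V \<Longrightarrow> nondegenerate (g x)"
    and g_smooth: "smooth_on (\<lambda>x. g x u v) V"
begin

abbreviation "\<Gamma> \<equiv> christoffel g"
abbreviation "R \<equiv> curvature g"

lemma g_differentiable: "x \<in> V \<Longrightarrow> (\<lambda>x. g x u v) differentiable (at x)"
  using smooth_on_differentiable[OF g_smooth] .

lemma g_linear: "x \<in> V \<Longrightarrow> linear (g x u)" "x \<in> V \<Longrightarrow> linear (\<lambda>u. g x u v)"
  using g_bilinear by (auto simp: bilinear_def)

lemma g_eqI: "x \<in> V \<Longrightarrow> (\<And>w. g x u w = g x v w) \<Longrightarrow> u = v"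
  using g_nondeg[of x] bilinear_lsub[OF g_bilinear[of x], of u v] unfolding nondegenerate_def
  by (metis eq_iff_diff_eq_0)

lemma Dg_linear: "x \<in> V \<Longrightarrow> linear (\<lambda>v. D (\<lambda>y. g y u v) x a)"
  by (rule linear_D_family[OF V_open _ g_linear(1) g_differentiable])

lemma Dg_sym: "x \<in> V \<Longrightarrow> D (\<lambda>y. g y u v) x a = D (\<lambda>y. g y v u) x a"
  by (rule D_cong_open[OF V_open _ g_sym])

lemma Dg_linear': "x \<in> V \<Longrightarrow> linear (\<lambda>u. D (\<lambda>y. g y u v) x a)"
  using Dg_linear[of x v a] Dg_sym by simp

lemma Dg_dir_linear: "x \<in> V \<Longrightarrow> linear (D (\<lambda>y. g y u v) x)"
  by (rule linear_frechet_derivative[OF g_differentiable])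

lemma gram_invertible: "x \<in> V \<Longrightarrow> invertible (gram (g x))"
  using invertible_gram_iff[OF g_bilinear g_sym] g_nondeg by blast

lemma koszul:
  assumes x: "x \<in> V"
  shows "2 * g x (\<Gamma> x u v) w =
    D (\<lambda>y. g y v w) x u + D (\<lambda>y. g y u w) x v - D (\<lambda>y. g y u v) x w"
proof -
  let ?K = "\<lambda>w. D (\<lambda>y. g y v w) x u + D (\<lambda>y. g y u w) x v - D (\<lambda>y. g y u v) x w"
  have l: "linear (\<lambda>w. 2 * g x (\<Gamma> x u v) w)"
    using linear_compose_scale_right[OF g_linear(1)[OF x], of 2] by simp
  have K: "linear ?K"
    by (intro linear_compose_add linear_compose_sub Dg_linear Dg_dir_linear x)
  have "gram (g x) *v \<Gamma> x u v = (\<chi> k. ?K (axis k 1) / 2)"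
    by (simp add: christoffel_def matrix_vector_mul_assoc matrix_inv_cancel gram_invertible x)
  then have e: "2 * g x (\<Gamma> x u v) (axis k 1) = ?K (axis k 1)" for k
    using gram_mult[OF g_bilinear[OF x], of "\<Gamma> x u v" k] by (simp add: g_sym[OF x])
  show ?thesis
    using linear_expand[OF l, of w] linear_expand[OF K, of w] unfolding e by (rule trans[OF _ sym])
qed

lemma \<Gamma>_sym: "x \<in> V \<Longrightarrow> \<Gamma> x u v = \<Gamma> x v u"
proof (rule g_eqI)
  fix w assume x: "x \<in> V"
  show "g x (\<Gamma> x u v) w = g x (\<Gamma> x v u) w"
    using koszul[OF x, of u v w] koszul[OF x, of v u w] Dg_sym[OF x, of u v w] by simp
qed

lemma \<Gamma>_linear: assumes x: "x \<in> V" shows "linear (\<Gamma> x u)"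
proof (rule linearI)
  fix v v' and r :: real
  note l = linear_add[OF Dg_linear[OF x]] linear_add[OF Dg_linear'[OF x]] linear_add[OF Dg_dir_linear[OF x]]
    linear_scale[OF Dg_linear[OF x]] linear_scale[OF Dg_linear'[OF x]] linear_scale[OF Dg_dir_linear[OF x]]
    linear_add[OF g_linear(2)[OF x]] linear_scale[OF g_linear(2)[OF x]]
  show "\<Gamma> x u (v + v') = \<Gamma> x u v + \<Gamma> x u v'"
  proof (rule g_eqI[OF x])
    fix w
    show "g x (\<Gamma> x u (v + v')) w = g x (\<Gamma> x u v + \<Gamma> x u v') w"
      using koszul[OF x, of u "v + v'" w] koszul[OF x, of u v w] koszul[OF x, of u v' w]
      by (simp add: l)
  qed
  show "\<Gamma> x u (r *\<^sub>R v) = r *\<^sub>R \<Gamma> x u v"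
  proof (rule g_eqI[OF x])
    fix w
    have "2 * g x (\<Gamma> x u (r *\<^sub>R v)) w = r * (2 * g x (\<Gamma> x u v) w)"
      unfolding koszul[OF x] by (simp add: l algebra_simps)
    then show "g x (\<Gamma> x u (r *\<^sub>R v)) w = g x (r *\<^sub>R \<Gamma> x u v) w" by (simp add: l)
  qed
qed

lemma \<Gamma>_bilinear: assumes x: "x \<in> V" shows "bilinear (\<Gamma> x)"
proof -
  have "(\<lambda>u. \<Gamma> x u v) = \<Gamma> x v" for v using \<Gamma>_sym[OF x] by auto
  then show ?thesis using \<Gamma>_linear[OF x] by (simp add: bilinear_def)
qed

lemma \<Gamma>_smooth: "smooth_on (\<lambda>x. \<Gamma> x u v) V"
  unfolding christoffel_def
proof (rule smooth_on_matrix_inv_mult[OF _ _ V_open gram_invertible])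
  show "smooth_on (\<lambda>x. gram (g x) $ i $ j) V" for i j
    using g_smooth by (simp add: gram_def)
  show "smooth_on (\<lambda>x. (\<chi> k. (D (\<lambda>y. g y v (axis k 1)) x u + D (\<lambda>y. g y u (axis k 1)) x v
      - D (\<lambda>y. g y u v) x (axis k 1)) / 2) $ i) V" for i
    unfolding vec_lambda_beta divide_inverse
    by (rule smooth_on_mult[OF smooth_on_diff[OF smooth_on_add[OF smooth_on_D[OF g_smooth]
          smooth_on_D[OF g_smooth] V_open] smooth_on_D[OF g_smooth] V_open] smooth_on_const V_open])
qed

lemma \<Gamma>_differentiable: "x \<in> V \<Longrightarrow> (\<lambda>y. \<Gamma> y u v) differentiable (at x)"
  using smooth_on_differentiable[OF \<Gamma>_smooth] .

lemma D\<Gamma>_differentiable: "x \<in> V \<Longrightarrow> (\<lambda>y. D (\<lambda>y. \<Gamma> y u v) y b) differentiable (at x)"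
  using smooth_on_differentiable[OF smooth_on_D[OF \<Gamma>_smooth]] .

lemma D\<Gamma>_linear: "x \<in> V \<Longrightarrow> linear (\<lambda>v. D (\<lambda>y. \<Gamma> y u v) x a)"
  by (rule linear_D_family[OF V_open _ \<Gamma>_linear \<Gamma>_differentiable])

lemma D\<Gamma>_linear': "x \<in> V \<Longrightarrow> linear (\<lambda>u. D (\<lambda>y. \<Gamma> y u v) x a)"
proof -
  assume x: "x \<in> V"
  have "D (\<lambda>y. \<Gamma> y u v) x a = D (\<lambda>y. \<Gamma> y v u) x a" for u
    by (rule D_cong_open[OF V_open x \<Gamma>_sym])
  then show ?thesis using D\<Gamma>_linear[OF x, of v a] by simp
qed

lemma D\<Gamma>_dir_linear: "x \<in> V \<Longrightarrow> linear (D (\<lambda>y. \<Gamma> y u v) x)"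
  by (rule linear_frechet_derivative[OF \<Gamma>_differentiable])

lemma metric_compatible:
  assumes x: "x \<in> V"
  shows "D (\<lambda>y. g y u v) x a = g x (\<Gamma> x a u) v + g x u (\<Gamma> x a v)"
  using koszul[OF x, of a u v] koszul[OF x, of a v u] Dg_sym[OF x, of u v a] g_sym[OF x, of u "\<Gamma> x a v"]
  by simp

text \<open>
  Compatibility with the metric for a vector field \<open>X\<close> and a constant field \<open>z\<close>: \<open>X' a + \<Gamma>(a,X)\<close> is the
  covariant derivative of \<open>X\<close>.
\<close>

lemma g_field_has_derivative:
  assumes x: "x \<in> V" and X: "(X has_derivative X') (at x)"
  shows "((\<lambda>y. g y (X y) z) has_derivative
    (\<lambda>a. g x (X' a + \<Gamma> x a (X x)) z + g x (X x) (\<Gamma> x a z))) (at x)"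
proof -
  have "((\<lambda>y. g y (X y) z) has_derivative (\<lambda>a. D (\<lambda>y. g y (X x) z) x a + g x (X' a) z)) (at x)"
    by (rule has_derivative_linear_family[OF V_open x g_linear(2) g_differentiable[OF x] X])
  then show ?thesis
    by (simp add: metric_compatible[OF x] linear_add[OF g_linear(2)[OF x]] algebra_simps)
qed

lemma \<Gamma>_field_has_derivative:
  assumes x: "x \<in> V" and X: "(X has_derivative X') (at x)"
  shows "((\<lambda>y. \<Gamma> y u (X y)) has_derivative
    (\<lambda>a. D (\<lambda>y. \<Gamma> y u (X x)) x a + \<Gamma> x u (X' a))) (at x)"
  by (rule has_derivative_linear_family[OF V_open x \<Gamma>_linear \<Gamma>_differentiable[OF x] X])

lemma R_smooth: "smooth_on (\<lambda>x. R x u v w) V"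
  unfolding curvature_def
  by (rule smooth_on_diff[OF smooth_on_add[OF smooth_on_diff[OF smooth_on_D[OF \<Gamma>_smooth] smooth_on_D[OF \<Gamma>_smooth] V_open]
       smooth_on_linear_family[OF V_open \<Gamma>_linear \<Gamma>_smooth \<Gamma>_smooth] V_open]
       smooth_on_linear_family[OF V_open \<Gamma>_linear \<Gamma>_smooth \<Gamma>_smooth] V_open])

lemma R_differentiable: "x \<in> V \<Longrightarrow> (\<lambda>y. R y u v w) differentiable (at x)"
  using smooth_on_differentiable[OF R_smooth] .

lemmas \<Gamma>_algebra = bilinear_ladd[OF \<Gamma>_bilinear] bilinear_radd[OF \<Gamma>_bilinear]
  bilinear_lsub[OF \<Gamma>_bilinear] bilinear_rsub[OF \<Gamma>_bilinear]
  bilinear_lmul[OF \<Gamma>_bilinear] bilinear_rmul[OF \<Gamma>_bilinear]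
  bilinear_lneg[OF \<Gamma>_bilinear] bilinear_rneg[OF \<Gamma>_bilinear]
  bilinear_rzero[OF \<Gamma>_bilinear]

lemmas g_algebra = bilinear_ladd[OF g_bilinear] bilinear_radd[OF g_bilinear]
  bilinear_lsub[OF g_bilinear] bilinear_rsub[OF g_bilinear]
  bilinear_lneg[OF g_bilinear] bilinear_rneg[OF g_bilinear] bilinear_lzero[OF g_bilinear]

lemma R_antisym: "R x u v w = - R x v u w"
  by (simp add: curvature_def)

lemma R_linear: "x \<in> V \<Longrightarrow> linear (\<lambda>u. R x u v w)"
  unfolding curvature_def
  by (rule linearI)
     (simp_all add: \<Gamma>_algebra linear_add[OF D\<Gamma>_linear'] linear_add[OF D\<Gamma>_dir_linear]
       linear_scale[OF D\<Gamma>_linear'] linear_scale[OF D\<Gamma>_dir_linear] algebra_simps)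

lemma R_linear_third: "x \<in> V \<Longrightarrow> linear (\<lambda>w. R x u v w)"
  unfolding curvature_def
  by (rule linearI)
     (simp_all add: \<Gamma>_algebra linear_add[OF D\<Gamma>_linear] linear_scale[OF D\<Gamma>_linear] algebra_simps)

lemma R_cyclic: "x \<in> V \<Longrightarrow> R x u v w + R x v w u + R x w u v = 0"
proof -
  assume x: "x \<in> V"
  have "D (\<lambda>y. \<Gamma> y u v) x a = D (\<lambda>y. \<Gamma> y v u) x a" for u v a
    by (rule D_cong_open[OF V_open x \<Gamma>_sym])
  from this[of v w u] this[of u w v] this[of u v w] \<Gamma>_sym[OF x, of v w] \<Gamma>_sym[OF x, of u w] \<Gamma>_sym[OF x, of u v]
  show ?thesis by (simp add: curvature_def)
qed

text \<open>
  Second derivatives of \<open>g(w,z)\<close> commute. Written with the connection, the derivative in directions \<open>v\<close> and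
  then \<open>u\<close> is \<open>g(\<nabla>\<^sub>u\<nabla>\<^sub>v w, z) + g(w, \<nabla>\<^sub>u\<nabla>\<^sub>v z)\<close> plus terms symmetric in \<open>u\<close> and \<open>v\<close>.
\<close>

lemma R_skew:
  assumes x: "x \<in> V"
  shows "g x (R x u v w) z = - g x (R x u v z) w"
proof -
  have DD: "D (\<lambda>y. D (\<lambda>y. g y w z) y v) x u =
      g x (D (\<lambda>y. \<Gamma> y v w) x u + \<Gamma> x u (\<Gamma> x v w)) z + g x (\<Gamma> x v w) (\<Gamma> x u z)
      + (g x (D (\<lambda>y. \<Gamma> y v z) x u + \<Gamma> x u (\<Gamma> x v z)) w + g x (\<Gamma> x v z) (\<Gamma> x u w))" for u v
  proof -
    have "D (\<lambda>y. D (\<lambda>y. g y w z) y v) x u = D (\<lambda>y. g y (\<Gamma> y v w) z + g y (\<Gamma> y v z) w) x u"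
      by (rule D_cong_open[OF V_open x]) (simp add: metric_compatible g_sym)
    also have "\<dots> = g x (D (\<lambda>y. \<Gamma> y v w) x u + \<Gamma> x u (\<Gamma> x v w)) z + g x (\<Gamma> x v w) (\<Gamma> x u z)
      + (g x (D (\<lambda>y. \<Gamma> y v z) x u + \<Gamma> x u (\<Gamma> x v z)) w + g x (\<Gamma> x v z) (\<Gamma> x u w))"
      by (rule D_eq[OF has_derivative_add[OF
            g_field_has_derivative[OF x has_derivative_D[OF \<Gamma>_differentiable[OF x]]]
            g_field_has_derivative[OF x has_derivative_D[OF \<Gamma>_differentiable[OF x]]]]])
    finally show ?thesis .
  qed
  have "D (\<lambda>y. D (\<lambda>y. g y w z) y v) x u = D (\<lambda>y. D (\<lambda>y. g y w z) y u) x v"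
    by (rule D_D_commute[OF g_smooth V_open x])
  then show ?thesis
    unfolding DD
    by (simp add: curvature_def g_algebra[OF x] g_sym[OF x, of "\<Gamma> x v w"] g_sym[OF x, of "\<Gamma> x v z"])
qed

lemma R_algebraic: "x \<in> V \<Longrightarrow> algebraic_curvature (g x) (R x)"
  by (rule algebraic_curvature.intro[OF g_bilinear g_sym g_nondeg R_linear R_antisym R_cyclic R_skew])

text \<open>
  The covariant derivative of the curvature tensor, evaluated on constant vector fields.
\<close>

definition nabla_R :: "real^'n \<Rightarrow> real^'n \<Rightarrow> real^'n \<Rightarrow> real^'n \<Rightarrow> real^'n \<Rightarrow> real^'n" where
  "nabla_R x a u v w = D (\<lambda>y. R y u v w) x a + \<Gamma> x a (R x u v w)
     - R x (\<Gamma> x a u) v w - R x u (\<Gamma> x a v) w - R x u v (\<Gamma> x a w)"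

lemma D_R:
  assumes x: "x \<in> V"
  shows "D (\<lambda>y. R y u v w) x a =
    D (\<lambda>y. D (\<lambda>y. \<Gamma> y v w) y u) x a - D (\<lambda>y. D (\<lambda>y. \<Gamma> y u w) y v) x a
    + (D (\<lambda>y. \<Gamma> y u (\<Gamma> x v w)) x a + \<Gamma> x u (D (\<lambda>y. \<Gamma> y v w) x a))
    - (D (\<lambda>y. \<Gamma> y v (\<Gamma> x u w)) x a + \<Gamma> x v (D (\<lambda>y. \<Gamma> y u w) x a))"
  unfolding curvature_def
  by (rule D_eq[OF has_derivative_diff[OF has_derivative_add[OF has_derivative_diff[OF
        has_derivative_D[OF D\<Gamma>_differentiable[OF x]] has_derivative_D[OF D\<Gamma>_differentiable[OF x]]]
        \<Gamma>_field_has_derivative[OF x has_derivative_D[OF \<Gamma>_differentiable[OF x]]]]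
        \<Gamma>_field_has_derivative[OF x has_derivative_D[OF \<Gamma>_differentiable[OF x]]]]])

text \<open>
  In the cyclic sum the terms with \<open>\<Gamma>\<close> in one of the first two slots of \<open>R\<close> cancel in pairs, as \<open>R\<close>
  is antisymmetric in these slots and \<open>\<Gamma>\<close> is symmetric. What remains, \<open>S\<close>, is the commutator
  \<open>[\<nabla>\<^sub>a, [\<nabla>\<^sub>u, \<nabla>\<^sub>v]]\<close> applied to \<open>w\<close>; its cyclic sum is zero by the Jacobi identity, whose analytic content is
  that second derivatives of \<open>\<Gamma>\<close> commute.
\<close>

lemma second_bianchi:
  assumes x: "x \<in> V"
  shows "nabla_R x a u v w + nabla_R x u v a w + nabla_R x v a u w = 0"
proof -
  define S where "S a u v = D (\<lambda>y. R y u v w) x a + \<Gamma> x a (R x u v w) - R x u v (\<Gamma> x a w)" for a u v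
  have DD: "D (\<lambda>y. D (\<lambda>y. \<Gamma> y v w) y u) x a = D (\<lambda>y. D (\<lambda>y. \<Gamma> y v w) y a) x u" for u v a
    by (rule D_D_commute[OF \<Gamma>_smooth V_open x])
  have "S a u v + S u v a + S v a u = 0"
    unfolding S_def D_R[OF x]
    using DD[of v u a] DD[of a v u] DD[of u v a]
    by (simp add: curvature_def \<Gamma>_algebra[OF x] algebra_simps)
  moreover have "R x (\<Gamma> x a u) v w + R x u (\<Gamma> x a v) w + (R x (\<Gamma> x u v) a w + R x v (\<Gamma> x u a) w)
      + (R x (\<Gamma> x v a) u w + R x a (\<Gamma> x v u) w) = 0"
    using R_antisym[of x u "\<Gamma> x a v" w] R_antisym[of x v "\<Gamma> x u a" w] R_antisym[of x a "\<Gamma> x v u" w]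
    by (simp add: \<Gamma>_sym[OF x, of v a] \<Gamma>_sym[OF x, of a u] \<Gamma>_sym[OF x, of v u])
  moreover have "nabla_R x a u v w + nabla_R x u v a w + nabla_R x v a u w = (S a u v + S u v a + S v a u)
      - (R x (\<Gamma> x a u) v w + R x u (\<Gamma> x a v) w + (R x (\<Gamma> x u v) a w + R x v (\<Gamma> x u a) w)
      + (R x (\<Gamma> x v a) u w + R x a (\<Gamma> x v u) w))"
    unfolding nabla_R_def S_def by simp
  ultimately show ?thesis by simp
qed

text \<open>
  Each symmetry is the derivative in direction \<open>a\<close> of the same symmetry of \<open>R\<close>; the correction terms of
  \<open>nabla_R\<close> are covered by that symmetry with one argument replaced by its image under \<open>\<Gamma> x a\<close>.
\<close>

lemma nabla_R_algebraic:
  assumes x: "x \<in> V"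
  shows "algebraic_curvature (g x) (nabla_R x a)"
proof (rule algebraic_curvature.intro)
  fix u v w z
  have dR: "((\<lambda>y. R y u v w) has_derivative D (\<lambda>y. R y u v w) x) (at x)" for u v w
    by (rule has_derivative_D[OF R_differentiable[OF x]])
  show "bilinear (g x)" "g x u v = g x v u" "nondegenerate (g x)"
    using g_bilinear g_sym g_nondeg x by auto
  have lin: "linear (\<lambda>u. R x (\<Gamma> x a u) v w)"
    using linear_compose[OF \<Gamma>_linear[OF x] R_linear[OF x]] by (simp add: o_def)
  have lin2: "linear (\<lambda>u. \<Gamma> x a (R x u v w))"
    using linear_compose[OF R_linear[OF x] \<Gamma>_linear[OF x]] by (simp add: o_def)
  show "linear (\<lambda>u. nabla_R x a u v w)"
    unfolding nabla_R_def
    by (intro linear_compose_add linear_compose_sub lin lin2 R_linear[OF x]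
        linear_D_family[OF V_open x R_linear R_differentiable[OF x]])
  have "D (\<lambda>y. R y u v w) x a = D (\<lambda>y. - R y v u w) x a"
    by (rule D_cong_open[OF V_open x]) (rule R_antisym)
  also have "\<dots> = - D (\<lambda>y. R y v u w) x a" by (rule D_eq[OF has_derivative_minus[OF dR]])
  finally have D_antisym: "D (\<lambda>y. R y u v w) x a = - D (\<lambda>y. R y v u w) x a" .
  show "nabla_R x a u v w = - nabla_R x a v u w"
    unfolding nabla_R_def D_antisym R_antisym[of x u] R_antisym[of x "\<Gamma> x a u"]
    by (simp add: \<Gamma>_algebra[OF x])
  have "D (\<lambda>y. R y u v w + R y v w u + R y w u v) x a = D (\<lambda>y. 0) x a"
    by (rule D_cong_open[OF V_open x]) (rule R_cyclic)
  then have D_cyclic: "D (\<lambda>y. R y u v w) x a + D (\<lambda>y. R y v w u) x a + D (\<lambda>y. R y w u v) x a = 0"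
    by (simp add: D_eq[OF has_derivative_add[OF has_derivative_add[OF dR dR] dR]])
  have \<Gamma>_cyclic: "\<Gamma> x a (R x u v w) + \<Gamma> x a (R x v w u) + \<Gamma> x a (R x w u v) = 0"
    using R_cyclic[OF x, of u v w] by (simp flip: \<Gamma>_algebra(2)[OF x] add: \<Gamma>_algebra(9)[OF x])
  have "nabla_R x a u v w + nabla_R x a v w u + nabla_R x a w u v =
      (D (\<lambda>y. R y u v w) x a + D (\<lambda>y. R y v w u) x a + D (\<lambda>y. R y w u v) x a)
      + (\<Gamma> x a (R x u v w) + \<Gamma> x a (R x v w u) + \<Gamma> x a (R x w u v))
      - (R x (\<Gamma> x a u) v w + R x v w (\<Gamma> x a u) + R x w (\<Gamma> x a u) v)
      - (R x u (\<Gamma> x a v) w + R x (\<Gamma> x a v) w u + R x w u (\<Gamma> x a v))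
      - (R x u v (\<Gamma> x a w) + R x v (\<Gamma> x a w) u + R x (\<Gamma> x a w) u v)"
    unfolding nabla_R_def by simp
  also have "\<dots> = 0"
    using R_cyclic[OF x, of "\<Gamma> x a u" v w] R_cyclic[OF x, of u "\<Gamma> x a v" w]
      R_cyclic[OF x, of u v "\<Gamma> x a w"] D_cyclic \<Gamma>_cyclic by (simp add: add_ac)
  finally show "nabla_R x a u v w + nabla_R x a v w u + nabla_R x a w u v = 0" .
  have "D (\<lambda>y. g y (R y u v w) z + g y (R y u v z) w) x a = D (\<lambda>y. 0) x a"
    by (rule D_cong_open[OF V_open x]) (simp add: R_skew[of _ u v w z])
  then have "g x (D (\<lambda>y. R y u v w) x a + \<Gamma> x a (R x u v w)) z + g x (R x u v w) (\<Gamma> x a z)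
      + (g x (D (\<lambda>y. R y u v z) x a + \<Gamma> x a (R x u v z)) w + g x (R x u v z) (\<Gamma> x a w)) = 0"
    by (simp add: D_eq[OF has_derivative_add[OF g_field_has_derivative[OF x dR]
            g_field_has_derivative[OF x dR]]])
  then show "g x (nabla_R x a u v w) z = - g x (nabla_R x a u v z) w"
    unfolding nabla_R_def
    using R_skew[OF x, of "\<Gamma> x a u" v w z] R_skew[OF x, of u "\<Gamma> x a v" w z]
      R_skew[OF x, of u v "\<Gamma> x a w" z] R_skew[OF x, of u v "\<Gamma> x a z" w]
    by (simp add: g_algebra[OF x])
qed

text \<open>
  Covariant differentiation commutes with contraction: the two terms in which \<open>\<Gamma> x a\<close> meets the
  contracted slot are traces of products in opposite order.
\<close>

lemma tr_nabla_R:
  assumes x: "x \<in> V"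
  shows "tr (\<lambda>u. nabla_R x a u v w) =
    D (\<lambda>y. ricci g y v w) x a - ricci g x (\<Gamma> x a v) w - ricci g x v (\<Gamma> x a w)"
proof -
  have "((\<lambda>y. R y (axis i 1) v w) has_derivative D (\<lambda>y. R y (axis i 1) v w) x) (at x)" for i
    by (rule has_derivative_D[OF R_differentiable[OF x]])
  then have "((\<lambda>y. \<Sum>i\<in>UNIV. R y (axis i 1) v w $ i) has_derivative
      (\<lambda>a. \<Sum>i\<in>UNIV. D (\<lambda>y. R y (axis i 1) v w) x a $ i)) (at x)"
    by (intro has_derivative_sum bounded_linear.has_derivative[OF bounded_linear_vec_nth])
  then have d: "D (\<lambda>y. ricci g y v w) x a = tr (\<lambda>u. D (\<lambda>y. R y u v w) x a)"
    unfolding ricci_def tr_def by (rule D_eq)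
  have c: "tr (\<lambda>u. \<Gamma> x a (R x u v w)) = tr (\<lambda>u. R x (\<Gamma> x a u) v w)"
    by (rule tr_commute[OF \<Gamma>_linear[OF x] R_linear[OF x]])
  show ?thesis
    unfolding nabla_R_def tr_diff tr_add d c unfolding ricci_def by simp
qed

lemma ricci_sym: "x \<in> V \<Longrightarrow> ricci g x v w = ricci g x w v"
  unfolding ricci_def by (rule algebraic_curvature.ricci_sym[OF R_algebraic])

lemma ricci_bilinear: assumes x: "x \<in> V" shows "bilinear (ricci g x)"
proof -
  have l: "linear (ricci g x v)" for v
    by (rule linearI) (simp_all add: ricci_def tr_def linear_add[OF R_linear_third[OF x]]
        linear_scale[OF R_linear_third[OF x]] sum.distrib sum_distrib_left)
  have "(\<lambda>u. ricci g x u v) = ricci g x v" for v using ricci_sym[OF x] by auto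
  then show ?thesis using l by (simp add: bilinear_def)
qed

text \<open>
  As the metric is parallel, the covariant derivative of the Einstein equation is \<open>D \<rho> x a\<close> times \<open>g\<close>, so the
  claim is \<open>schur_pointwise\<close> for the curvature at \<open>x\<close>.
\<close>

theorem schur:
  assumes \<rho>: "\<And>x. x \<in> V \<Longrightarrow> \<rho> differentiable (at x)"
    and einstein: "\<And>x v w. x \<in> V \<Longrightarrow> ricci g x v w = \<rho> x * g x v w"
    and n: "CARD('n) \<ge> 3" and x: "x \<in> V"
  shows "D \<rho> x a = 0"
proof (rule schur_pointwise[OF nabla_R_algebraic[OF x] second_bianchi[OF x] _ _ n])
  show "linear (D \<rho> x)" by (rule linear_frechet_derivative[OF \<rho>[OF x]])
  fix a v w
  have "D (\<lambda>y. ricci g y v w) x a = D (\<lambda>y. \<rho> y * g y v w) x a"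
    by (rule D_cong_open[OF V_open x einstein])
  also have "\<dots> = \<rho> x * D (\<lambda>y. g y v w) x a + D \<rho> x a * g x v w"
    by (rule D_eq[OF has_derivative_mult[OF has_derivative_D[OF \<rho>[OF x]]
            has_derivative_D[OF g_differentiable[OF x]]]])
  finally show "tr (\<lambda>u. nabla_R x a u v w) = D \<rho> x a * g x v w"
    by (simp add: tr_nabla_R[OF x] einstein[OF x] metric_compatible[OF x] algebra_simps)
qed

end

lemma local_metric_subset:
  assumes "local_metric V g" "open U" "U \<subseteq> V"
  shows "local_metric U g"
proof -
  interpret local_metric V g by fact
  show ?thesis
    using assms(2,3) g_bilinear g_sym g_nondeg smooth_on_subset[OF g_smooth assms(3)]
    by (intro local_metric.intro) (auto simp: subset_iff)
qed

section \<open>Naturality of the Ricci tensor\<close>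

text \<open>
  These conditions force the Jacobian of \<open>\<phi>\<close> to be invertible: a vector in its kernel is orthogonal to
  everything with respect to \<open>g\<close>.
\<close>

locale metric_pullback =
  source: local_metric V g + target: local_metric V' g'
  for V :: "(real^'n) set" and g and V' :: "(real^'n) set" and g' +
  fixes \<phi> :: "real^'n \<Rightarrow> real^'n"
  assumes \<phi>_smooth: "smooth_on \<phi> V" and \<phi>_into: "x \<in> V \<Longrightarrow> \<phi> x \<in> V'"
    and pullback: "x \<in> V \<Longrightarrow> g x u v = g' (\<phi> x) (D \<phi> x u) (D \<phi> x v)"
begin

abbreviation "P \<equiv> D \<phi>"
abbreviation "Q x u v \<equiv> D (\<lambda>y. P y v) x u"

lemma P_linear: "x \<in> V \<Longrightarrow> linear (P x)"
  by (rule linear_frechet_derivative[OF smooth_on_differentiable[OF \<phi>_smooth]])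

lemma P_inj: "x \<in> V \<Longrightarrow> inj (P x)"
proof -
  assume x: "x \<in> V"
  have "u = 0" if "P x u = 0" for u
    using source.g_nondeg[OF x] pullback[OF x] that
      bilinear_lzero[OF target.g_bilinear[OF \<phi>_into[OF x]]]
    unfolding nondegenerate_def by metis
  then show ?thesis using linear_injective_0[OF P_linear[OF x]] by blast
qed

lemma P_inverse:
  assumes "x \<in> V"
  obtains J where "linear J" "\<And>u. J (P x u) = u" "\<And>u. P x (J u) = u"
  using linear_injective_isomorphism[OF P_linear P_inj] assms by blast

lemma P_has_derivative: "x \<in> V \<Longrightarrow> ((\<lambda>y. P y u) has_derivative (\<lambda>a. Q x a u)) (at x)"
  using has_derivative_D[OF smooth_on_differentiable[OF smooth_on_D[OF \<phi>_smooth]]] .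

lemma Q_sym: "x \<in> V \<Longrightarrow> Q x u v = Q x v u"
  by (rule D_D_commute[OF \<phi>_smooth source.V_open])

lemma Dg_pullback:
  assumes x: "x \<in> V"
  shows "D (\<lambda>y. g y u v) x a = D (\<lambda>z. g' z (P x u) (P x v)) (\<phi> x) (P x a)
    + g' (\<phi> x) (Q x a u) (P x v) + g' (\<phi> x) (P x u) (Q x a v)"
proof -
  have \<phi>': "(\<phi> has_derivative P x) (at x)"
    by (rule has_derivative_D[OF smooth_on_differentiable[OF \<phi>_smooth x]])
  have c: "((\<lambda>y. g' (\<phi> y) p q) has_derivative (\<lambda>a. D (\<lambda>z. g' z p q) (\<phi> x) (P x a))) (at x)" for p q
    by (rule has_derivative_chain[OF \<phi>' target.g_differentiable[OF \<phi>_into[OF x]]])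
  have "D (\<lambda>y. g y u v) x a = D (\<lambda>y. g' (\<phi> y) (P y u) (P y v)) x a"
    by (rule D_cong_open[OF source.V_open x pullback])
  also have "\<dots> = D (\<lambda>y. g' (\<phi> y) (P x u) (P x v)) x a
      + g' (\<phi> x) (Q x a u) (P x v) + g' (\<phi> x) (P x u) (Q x a v)"
    by (rule D_eq[OF has_derivative_bilinear_family[OF source.V_open x target.g_bilinear[OF \<phi>_into]
            _ P_has_derivative[OF x] P_has_derivative[OF x]]])
       (use c in \<open>auto simp: differentiable_def\<close>)
  finally show ?thesis by (simp only: D_eq[OF c])
qed

text \<open>
  The familiar inhomogeneous transformation law. When Koszul's formula is pulled back, the second
  derivatives \<open>Q\<close> of \<open>\<phi>\<close> occur six times; four of them cancel by their symmetry.
\<close>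

lemma christoffel_pullback:
  assumes x: "x \<in> V"
  shows "P x (source.\<Gamma> x u v) = target.\<Gamma> (\<phi> x) (P x u) (P x v) + Q x u v"
proof (rule target.g_eqI[OF \<phi>_into[OF x]])
  fix w'
  note b = target.g_bilinear[OF \<phi>_into[OF x]]
  obtain w where w: "w' = P x w" using P_inverse[OF x] by metis
  have "2 * g' (\<phi> x) (P x (source.\<Gamma> x u v)) (P x w) = 2 * g x (source.\<Gamma> x u v) w"
    by (simp add: pullback[OF x])
  also have "\<dots> = 2 * g' (\<phi> x) (target.\<Gamma> (\<phi> x) (P x u) (P x v)) (P x w) + 2 * g' (\<phi> x) (Q x u v) (P x w)"
    unfolding source.koszul[OF x] target.koszul[OF \<phi>_into[OF x]] Dg_pullback[OF x]
    by (simp add: Q_sym[OF x, of v u] Q_sym[OF x, of w u] Q_sym[OF x, of w v]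
        target.g_sym[OF \<phi>_into[OF x], of "P x v"] target.g_sym[OF \<phi>_into[OF x], of "P x u"])
  finally show "g' (\<phi> x) (P x (source.\<Gamma> x u v)) w'
      = g' (\<phi> x) (target.\<Gamma> (\<phi> x) (P x u) (P x v) + Q x u v) w'"
    by (simp add: w bilinear_ladd[OF b])
qed

lemma D_christoffel_pullback:
  assumes x: "x \<in> V"
  shows "Q x a (source.\<Gamma> x u v) + P x (D (\<lambda>y. source.\<Gamma> y u v) x a) =
    D (\<lambda>z. target.\<Gamma> z (P x u) (P x v)) (\<phi> x) (P x a)
    + target.\<Gamma> (\<phi> x) (Q x a u) (P x v) + target.\<Gamma> (\<phi> x) (P x u) (Q x a v)
    + D (\<lambda>y. Q y u v) x a"
proof -
  have \<phi>': "(\<phi> has_derivative P x) (at x)"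
    by (rule has_derivative_D[OF smooth_on_differentiable[OF \<phi>_smooth x]])
  have c: "((\<lambda>y. target.\<Gamma> (\<phi> y) p q) has_derivative (\<lambda>a. D (\<lambda>z. target.\<Gamma> z p q) (\<phi> x) (P x a))) (at x)"
    for p q
    by (rule has_derivative_chain[OF \<phi>' target.\<Gamma>_differentiable[OF \<phi>_into[OF x]]])
  have "((\<lambda>y. P y (source.\<Gamma> y u v)) has_derivative
      (\<lambda>a. D (\<lambda>y. P y (source.\<Gamma> x u v)) x a + P x (D (\<lambda>y. source.\<Gamma> y u v) x a))) (at x)"
    by (rule has_derivative_linear_family[OF source.V_open x P_linear _
          has_derivative_D[OF source.\<Gamma>_differentiable[OF x]]])
       (use P_has_derivative[OF x] in \<open>auto simp: differentiable_def\<close>)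
  then have "Q x a (source.\<Gamma> x u v) + P x (D (\<lambda>y. source.\<Gamma> y u v) x a)
      = D (\<lambda>y. P y (source.\<Gamma> y u v)) x a"
    by (rule D_eq[symmetric])
  also have "\<dots> = D (\<lambda>y. target.\<Gamma> (\<phi> y) (P y u) (P y v) + Q y u v) x a"
    by (rule D_cong_open[OF source.V_open x christoffel_pullback])
  also have "\<dots> = D (\<lambda>y. target.\<Gamma> (\<phi> y) (P x u) (P x v)) x a
      + target.\<Gamma> (\<phi> x) (Q x a u) (P x v) + target.\<Gamma> (\<phi> x) (P x u) (Q x a v) + D (\<lambda>y. Q y u v) x a"
  proof (rule D_eq[OF has_derivative_add])
    show "((\<lambda>y. target.\<Gamma> (\<phi> y) (P y u) (P y v)) has_derivative
      (\<lambda>a. D (\<lambda>y. target.\<Gamma> (\<phi> y) (P x u) (P x v)) x a + target.\<Gamma> (\<phi> x) (Q x a u) (P x v)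
        + target.\<Gamma> (\<phi> x) (P x u) (Q x a v))) (at x)"
      by (rule has_derivative_bilinear_family[OF source.V_open x target.\<Gamma>_bilinear[OF \<phi>_into]
            _ P_has_derivative[OF x] P_has_derivative[OF x]])
         (use c in \<open>auto simp: differentiable_def\<close>)
    show "((\<lambda>y. Q y u v) has_derivative D (\<lambda>y. Q y u v) x) (at x)"
      by (rule has_derivative_D[OF smooth_on_differentiable[OF smooth_on_D[OF smooth_on_D[OF \<phi>_smooth]] x]])
  qed
  finally show ?thesis by (simp only: D_eq[OF c])
qed

text \<open>
  Differentiating the transformation law of \<open>\<Gamma>\<close> and adding the quadratic term, all inhomogeneous
  contributions collect in the last bracket of \<open>half\<close>. That bracket is symmetric in \<open>u\<close> and \<open>v\<close>, because second and third
  derivatives of \<open>\<phi>\<close> commute, so it drops out of the curvature.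
\<close>

lemma curvature_pullback:
  assumes x: "x \<in> V"
  shows "P x (source.R x u v w) = target.R (\<phi> x) (P x u) (P x v) (P x w)"
proof -
  note \<phi>x = \<phi>_into[OF x]
  have C: "D (\<lambda>y. Q y u w) x v = D (\<lambda>y. Q y v w) x u"
    by (rule D_D_commute[OF smooth_on_D[OF \<phi>_smooth] source.V_open x])
  have half: "P x (D (\<lambda>y. source.\<Gamma> y v w) x u) + P x (source.\<Gamma> x u (source.\<Gamma> x v w)) =
      D (\<lambda>z. target.\<Gamma> z (P x v) (P x w)) (\<phi> x) (P x u)
      + target.\<Gamma> (\<phi> x) (P x u) (target.\<Gamma> (\<phi> x) (P x v) (P x w))
      + (target.\<Gamma> (\<phi> x) (Q x u v) (P x w) + target.\<Gamma> (\<phi> x) (P x v) (Q x u w)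
         + target.\<Gamma> (\<phi> x) (P x u) (Q x v w) + D (\<lambda>y. Q y v w) x u)" for u v
    using D_christoffel_pullback[OF x, where a = u and u = v and v = w]
    by (simp add: christoffel_pullback[OF x] target.\<Gamma>_algebra[OF \<phi>x] algebra_simps)
  show ?thesis
    using half[of u v] half[of v u] C Q_sym[OF x, of v u]
    by (simp add: curvature_def linear_add[OF P_linear[OF x]] linear_diff[OF P_linear[OF x]] algebra_simps)
qed

theorem ricci_pullback:
  assumes x: "x \<in> V"
  shows "ricci g x v w = ricci g' (\<phi> x) (P x v) (P x w)"
proof -
  obtain J where J: "linear J" "\<And>u. J (P x u) = u" "\<And>u. P x (J u) = u"
    using P_inverse[OF x] by blast
  let ?F = "\<lambda>u. target.R (\<phi> x) (P x u) (P x v) (P x w)"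
  have F: "linear ?F"
    using linear_compose[OF P_linear[OF x] target.R_linear[OF \<phi>_into[OF x]]] by (simp add: o_def)
  have "source.R x u v w = J (?F u)" for u
    using J(2)[of "source.R x u v w"] by (simp add: curvature_pullback[OF x])
  then show ?thesis
    unfolding ricci_def by (simp add: tr_commute[OF J(1) F] J(3))
qed

end

section \<open>The spray and the Ricci scalar of a quadratic Lagrangian\<close>

lemma has_derivative_fst_family:
  fixes f :: "'a::real_normed_vector \<Rightarrow> 'c::real_normed_vector"
  assumes "f differentiable (at (fst z))"
  shows "((\<lambda>z. f (fst z)) has_derivative (\<lambda>h. D f (fst z) (fst h))) (at z)"
  by (rule has_derivative_chain[OF has_derivative_fst[OF has_derivative_ident] assms])

lemma has_derivative_tangent_linear:
  fixes P :: "real^'n \<Rightarrow> real^'n \<Rightarrow> 'b::real_normed_vector"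
  assumes V: "open V" "fst z \<in> V" and P: "\<And>x. x \<in> V \<Longrightarrow> linear (P x)"
    and d: "\<And>u. (\<lambda>x. P x u) differentiable (at (fst z))"
  shows "((\<lambda>z. P (fst z) (snd z)) has_derivative
    (\<lambda>h. D (\<lambda>x. P x (snd z)) (fst z) (fst h) + P (fst z) (snd h))) (at z)"
proof -
  have o: "open (fst -` V)" "z \<in> fst -` V" using V by (auto intro: open_vimage_fst)
  have "((\<lambda>z. P (fst z) (snd z)) has_derivative
    (\<lambda>h. D (\<lambda>y. P (fst y) (snd z)) z h + P (fst z) (snd h))) (at z)"
    by (rule has_derivative_linear_family[OF o _ _ has_derivative_snd[OF has_derivative_ident]])
       (use P has_derivative_fst_family[OF d] in \<open>auto simp: differentiable_def\<close>)
  then show ?thesis by (simp only: D_eq[OF has_derivative_fst_family[OF d]])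
qed

lemma has_derivative_tangent_quadratic:
  fixes B :: "real^'n \<Rightarrow> real^'n \<Rightarrow> real^'n \<Rightarrow> 'b::real_normed_vector"
  assumes V: "open V" "fst z \<in> V" and B: "\<And>x. x \<in> V \<Longrightarrow> bilinear (B x)"
    and d: "\<And>u v. (\<lambda>x. B x u v) differentiable (at (fst z))"
  shows "((\<lambda>z. B (fst z) (snd z) (snd z)) has_derivative
    (\<lambda>h. D (\<lambda>x. B x (snd z) (snd z)) (fst z) (fst h) + B (fst z) (snd h) (snd z)
      + B (fst z) (snd z) (snd h))) (at z)"
proof -
  have o: "open (fst -` V)" "z \<in> fst -` V" using V by (auto intro: open_vimage_fst)
  have "((\<lambda>z. B (fst z) (snd z) (snd z)) has_derivative
    (\<lambda>h. D (\<lambda>y. B (fst y) (snd z) (snd z)) z h + B (fst z) (snd h) (snd z)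
      + B (fst z) (snd z) (snd h))) (at z)"
    by (rule has_derivative_bilinear_family[OF o _ _ has_derivative_snd[OF has_derivative_ident]
          has_derivative_snd[OF has_derivative_ident]])
       (use B has_derivative_fst_family[OF d] in \<open>auto simp: differentiable_def\<close>)
  then show ?thesis by (simp only: D_eq[OF has_derivative_fst_family[OF d]])
qed

lemma dx_dy_cong:
  assumes "(H has_derivative H') (at z)" "open W" "z \<in> W" "\<And>z. z \<in> W \<Longrightarrow> H z = F z"
  shows "dx i F z = H' (axis i 1, 0)" "dy i F z = H' (0, axis i 1)"
  using has_derivative_cong_open[OF assms] by (simp_all add: dx_def dy_def D_eq)

text \<open>
  It is by this lemma that the non-degeneracy of the fundamental tensor is carried over to \<open>g\<close>, so it
  has to precede any use of \<open>g\<close> as a \<open>local_metric\<close>. The function \<open>F\<close> is only known on an open set of pairs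
  \<open>(x, y)\<close>, which is enough to compute its derivatives.
\<close>

lemma fund_tensor_quadratic:
  fixes g :: "real^'n \<Rightarrow> real^'n \<Rightarrow> real^'n \<Rightarrow> real"
  assumes W: "open W" and V: "open V" "fst ` W \<subseteq> V" and F: "\<And>z. z \<in> W \<Longrightarrow> g (fst z) (snd z) (snd z) = F z"
    and b: "\<And>x. x \<in> V \<Longrightarrow> bilinear (g x)" and sym: "\<And>x u v. x \<in> V \<Longrightarrow> g x u v = g x v u"
    and d: "\<And>x u v. x \<in> V \<Longrightarrow> (\<lambda>x. g x u v) differentiable (at x)"
    and z: "z \<in> W"
  shows "fund_tensor F z = gram (g (fst z))"
proof -
  have l: "linear (g x u)" "linear (\<lambda>u. g x u v)" if "x \<in> V" for x u v
    using b[OF that] by (auto simp: bilinear_def)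
  have WV: "fst z \<in> V" if "z \<in> W" for z using V that by auto
  have dy1: "2 * g (fst z) (axis j 1) (snd z) = dy j F z" if z: "z \<in> W" for z j
    by (subst dx_dy_cong(2)[OF has_derivative_tangent_quadratic[OF V(1) WV[OF z] b d[OF WV[OF z]]] W z F])
       (simp_all add: linear_0[OF linear_frechet_derivative[OF d[OF WV[OF z]]]] sym[OF WV[OF z], of _ "axis j 1"])
  have dy2: "dy i (dy j F) z = 2 * g (fst z) (axis i 1) (axis j 1)" for i j
  proof -
    have l2: "linear (\<lambda>u. 2 * g x (axis j 1) u)" if "x \<in> V" for x
      using linear_compose_scale_right[OF l(1)[OF that], of 2] by simp
    have d2: "(\<lambda>x. 2 * g x (axis j 1) u) differentiable (at (fst z))" for u
      using d[OF WV[OF z]] by (intro differentiable_mult) auto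
    have "dy i (dy j F) z = D (\<lambda>x. 2 * g x (axis j 1) (snd z)) (fst z) 0 + 2 * g (fst z) (axis j 1) (axis i 1)"
      by (subst dx_dy_cong(2)[OF has_derivative_tangent_linear[OF V(1) WV[OF z] l2 d2] W z dy1]) simp_all
    then show ?thesis
      by (simp add: linear_0[OF linear_frechet_derivative[OF d2]] sym[OF WV[OF z], of "axis j 1"])
  qed
  show ?thesis by (simp add: fund_tensor_def gram_def dy2)
qed

context local_metric
begin

text \<open>
  The sum over \<open>a, b\<close> in the definition of the spray evaluates three bilinear forms at
  \<open>(y, y)\<close>, and gives twice the vector in the definition of the Christoffel symbols.
\<close>

lemma spray_coeff_quadratic:
  assumes W: "open W" "fst ` W \<subseteq> V" and F: "\<And>z. z \<in> W \<Longrightarrow> g (fst z) (snd z) (snd z) = F z"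
    and z: "z \<in> W"
  shows "spray_coeff F i z = \<Gamma> (fst z) (snd z) (snd z) $ i / 2"
proof -
  obtain x y where xy: "z = (x, y)" by (cases z)
  have x: "x \<in> V" using z W xy by force
  have ft: "fund_tensor F z = gram (g (fst z))" if "z \<in> W" for z
    by (rule fund_tensor_quadratic[OF W(1) V_open W(2) F g_bilinear g_sym g_differentiable that])
  have dxg: "dx a (\<lambda>z. fund_tensor F z $ c $ b) z = D (\<lambda>x. g x (axis c 1) (axis b 1)) x (axis a 1)"
    for a b c
    by (subst dx_dy_cong(1)[OF has_derivative_fst_family[OF g_differentiable] W(1) z])
       (use x xy in \<open>auto simp: ft gram_def\<close>)
  let ?e = "\<lambda>i. axis i 1 :: real^'n"
  let ?k = "\<lambda>c a b. D (\<lambda>x. g x (?e c) (?e b)) x (?e a) + D (\<lambda>x. g x (?e a) (?e c)) x (?e b)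
    - D (\<lambda>x. g x (?e a) (?e b)) x (?e c)"
  have k: "(\<Sum>a\<in>UNIV. \<Sum>b\<in>UNIV. ?k c a b * y $ a * y $ b) =
      D (\<lambda>x. g x y (?e c)) x y + D (\<lambda>x. g x y (?e c)) x y - D (\<lambda>x. g x y y) x (?e c)" for c
  proof -
    have 1: "(\<Sum>a\<in>UNIV. \<Sum>b\<in>UNIV. B (?e a) (?e b) * y $ a * y $ b) = B y y"
      if "bilinear B" for B :: "real^'n \<Rightarrow> real^'n \<Rightarrow> real"
    proof -
      have "linear (\<lambda>u. B u y)" "\<And>u. linear (B u)" using that by (auto simp: bilinear_def)
      from linear_expand[OF this(1), of y] linear_expand[OF this(2), of _ y] show ?thesis
        by (simp add: sum_distrib_left mult_ac)
    qed
    have lin: "linear (\<lambda>v. D (\<lambda>x. g x v w) x u)" "linear (\<lambda>v. D (\<lambda>x. g x w v) x u)"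
      "linear (\<lambda>u. D (\<lambda>x. g x w v) x u)" for u v w
      using Dg_linear'[OF x] Dg_linear[OF x] Dg_dir_linear[OF x] by auto
    have "bilinear (\<lambda>a b. D (\<lambda>x. g x (?e c) b) x a)" "bilinear (\<lambda>a b. D (\<lambda>x. g x a (?e c)) x b)"
      "bilinear (\<lambda>a b. D (\<lambda>x. g x a b) x (?e c))"
      unfolding bilinear_def using lin by auto
    from 1[OF this(1)] 1[OF this(2)] 1[OF this(3)] show ?thesis
      by (simp add: left_diff_distrib distrib_right sum.distrib sum_subtractf Dg_sym[OF x, of y "?e c"])
  qed
  have "spray_coeff F i z = (1/4) * (\<Sum>c\<in>UNIV. \<Sum>a\<in>UNIV. \<Sum>b\<in>UNIV.
      matrix_inv (gram (g x)) $ i $ c * ?k c a b * y $ a * y $ b)"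
    unfolding spray_coeff_def Let_def dxg ft[OF z] by (simp add: xy)
  also have "\<dots> = (1/4) * (\<Sum>c\<in>UNIV. matrix_inv (gram (g x)) $ i $ c *
      (D (\<lambda>x. g x y (?e c)) x y + D (\<lambda>x. g x y (?e c)) x y - D (\<lambda>x. g x y y) x (?e c)))"
    unfolding k[symmetric] by (simp only: sum_distrib_left mult.assoc)
  also have "\<dots> = \<Gamma> (fst z) (snd z) (snd z) $ i / 2"
    by (simp add: christoffel_def matrix_vector_mult_def xy sum_divide_distrib sum_distrib_left)
  finally show ?thesis .
qed

text \<open>
  With \<open>G\<^sup>i = \<Gamma>\<^sup>i(y,y)/2\<close> the first and second \<open>y\<close>-derivatives of the spray are \<open>\<Gamma>(e\<^sub>j, y)\<close> and \<open>\<Gamma>(e\<^sub>i, e\<^sub>j)\<close>,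
  and the four sums in the Ricci scalar are the traces of the four terms of \<open>u \<mapsto> R(u, y) y\<close>, in a different order.
\<close>

theorem ricci_coord_quadratic:
  assumes W: "open W" "fst ` W \<subseteq> V" and F: "\<And>z. z \<in> W \<Longrightarrow> g (fst z) (snd z) (snd z) = F z"
    and z: "z \<in> W"
  shows "ricci_coord F z = ricci g (fst z) (snd z) (snd z)"
proof -
  let ?e = "\<lambda>i. axis i 1 :: real^'n"
  let ?G = "spray_coeff F"
  obtain x y where xy: "z = (x, y)" by (cases z)
  have WV: "fst z \<in> V" if "z \<in> W" for z using W that by auto
  have x: "x \<in> V" using WV[OF z] xy by simp
  have G: "\<Gamma> (fst z) (snd z) (snd z) $ i / 2 = ?G i z" if "z \<in> W" for i z
    using spray_coeff_quadratic[OF W F that] by simp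
  have nth: "((\<lambda>z. f z $ i) has_derivative (\<lambda>h. f' h $ i)) F"
    if "(f has_derivative f') F" for f :: "(real^'n) \<times> (real^'n) \<Rightarrow> real^'n" and f' F i
    by (rule bounded_linear.has_derivative[OF bounded_linear_vec_nth that])
  have nth2: "((\<lambda>z. f z $ i / 2) has_derivative (\<lambda>h. f' h $ i / 2)) F"
    if "(f has_derivative f') F" for f :: "(real^'n) \<times> (real^'n) \<Rightarrow> real^'n" and f' F i
    using has_derivative_mult_left[OF nth[OF that], of i "1/2"] by simp
  note D0 = linear_0[OF D\<Gamma>_dir_linear] bilinear_lzero[OF \<Gamma>_bilinear] bilinear_rzero[OF \<Gamma>_bilinear]
  have bf: "((\<lambda>z. \<Gamma> (fst z) (snd z) (snd z)) has_derivative
      (\<lambda>h. D (\<lambda>x. \<Gamma> x (snd z) (snd z)) (fst z) (fst h) + \<Gamma> (fst z) (snd h) (snd z)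
        + \<Gamma> (fst z) (snd z) (snd h))) (at z)" if "z \<in> W" for z
    by (rule has_derivative_tangent_quadratic[OF V_open WV[OF that] \<Gamma>_bilinear \<Gamma>_differentiable[OF WV[OF that]]])
  note dG = dx_dy_cong[OF nth2[OF bf] W(1) _ G]
  have dxG: "dx i (?G i) z = D (\<lambda>x. \<Gamma> x y y) x (?e i) $ i / 2" for i
    by (subst dG(1)[OF z z]) (simp_all add: D0 x xy)
  have dyG: "\<Gamma> (fst z) (?e j) (snd z) $ i = dy j (?G i) z" if z: "z \<in> W" for i j z
    by (subst dG(2)[OF z z])
       (simp_all add: D0 WV[OF z] \<Gamma>_sym[OF WV[OF z], of _ "?e j"] linear_0[OF D\<Gamma>_dir_linear[OF WV[OF z]]])
  note dyG' = dx_dy_cong[OF nth[OF has_derivative_tangent_linear[OF V_open WV[OF z] \<Gamma>_linear \<Gamma>_differentiable[OF WV[OF z]]]]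
      W(1) z dyG]
  have dxdyG: "dx j (dy i (?G i)) z = D (\<lambda>x. \<Gamma> x (?e i) y) x (?e j) $ i" for i j
    by (subst dyG'(1)) (simp_all add: D0 x xy)
  have dydyG: "dy j (dy i (?G i)) z = \<Gamma> x (?e i) (?e j) $ i" for i j
    by (subst dyG'(2)) (simp_all add: linear_0[OF D\<Gamma>_dir_linear[OF x]] x xy)
  have Gz: "?G j z = \<Gamma> x y y $ j / 2" for j
    using G[OF z, of j] by (metis xy fst_conv snd_conv)
  have dyz: "dy j (?G i) z = \<Gamma> x (?e j) y $ i" for i j
    using dyG[OF z, of j i] by (metis xy fst_conv snd_conv)
  have t1: "2 * (\<Sum>i\<in>UNIV. dx i (?G i) z) = tr (\<lambda>u. D (\<lambda>x. \<Gamma> x y y) x u)"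
    by (simp add: dxG tr_def sum_distrib_left)
  have t2: "(\<Sum>i\<in>UNIV. \<Sum>j\<in>UNIV. y $ j * dx j (dy i (?G i)) z) = tr (\<lambda>u. D (\<lambda>x. \<Gamma> x u y) x y)"
    using linear_expand[OF D\<Gamma>_dir_linear[OF x], of _ _ y] by (simp add: dxdyG tr_def)
  have t3: "2 * (\<Sum>i\<in>UNIV. \<Sum>j\<in>UNIV. ?G j z * dy j (dy i (?G i)) z) = tr (\<lambda>u. \<Gamma> x u (\<Gamma> x y y))"
    using linear_expand[OF \<Gamma>_linear[OF x], of _ "\<Gamma> x y y"]
    by (simp add: dydyG tr_def Gz sum_distrib_left)
  have t4: "(\<Sum>i\<in>UNIV. \<Sum>j\<in>UNIV. dy j (?G i) z * dy i (?G j) z) = tr (\<lambda>u. \<Gamma> x y (\<Gamma> x u y))"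
    using linear_expand[OF \<Gamma>_linear[OF x], of y "\<Gamma> x _ y"]
    by (simp add: dyz tr_def \<Gamma>_sym[OF x, of y "axis _ 1"] mult.commute)
  have "ricci_coord F z = tr (\<lambda>u. D (\<lambda>x. \<Gamma> x y y) x u) - tr (\<lambda>u. D (\<lambda>x. \<Gamma> x u y) x y)
      + tr (\<lambda>u. \<Gamma> x u (\<Gamma> x y y)) - tr (\<lambda>u. \<Gamma> x y (\<Gamma> x u y))"
    unfolding ricci_coord_def Let_def t1[symmetric] t2[symmetric] t3[symmetric] t4[symmetric]
    by (simp add: xy)
  also have "\<dots> = ricci g (fst z) (snd z) (snd z)"
    by (simp add: ricci_def curvature_def xy tr_add tr_diff)
  finally show ?thesis .
qed

end

section \<open>Charts and tangent vectors\<close>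

abbreviation pt :: "('m, 'n::finite) chart \<Rightarrow> real^'n \<Rightarrow> 'm" where
  "pt c \<equiv> inv_into (fst c) (snd c)"

text \<open>
  The tangent vector at \<open>x\<close> with components \<open>w\<close> in the chart \<open>c\<close>. Unlike \<open>coord_vec\<close>, it is given
  by a formula and by a base point on the manifold, which makes changes of chart a matter of the chain rule.
\<close>

definition vec_at ::
    "('m, 'n::finite) chart set \<Rightarrow> ('m, 'n) chart \<Rightarrow> 'm \<Rightarrow> real^'n \<Rightarrow> ('m, 'n) tvec" where
  "vec_at At c x w = (\<lambda>d. if d \<in> At \<and> x \<in> fst d then D (transition c d) (snd c x) w else 0)"

locale manifold =
  fixes M :: "'m topology" and At :: "('m, 'n::finite) chart set"
  assumes manifold: "smooth_manifold M At"
begin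

lemma chart: "c \<in> At \<Longrightarrow> chart_on M c"
  using manifold by (auto simp: smooth_manifold_def)

lemma chart_open: "c \<in> At \<Longrightarrow> openin M (fst c)"
  using chart by (auto simp: chart_on_def)

lemma chart_image_open: "c \<in> At \<Longrightarrow> open (snd c ` fst c)"
  using chart by (auto simp: chart_on_def)

lemma chart_homeo: "c \<in> At \<Longrightarrow> homeomorphic_map (subtopology M (fst c)) (top_of_set (snd c ` fst c)) (snd c)"
  using chart by (auto simp: chart_on_def)

lemma chart_topspace: "c \<in> At \<Longrightarrow> topspace (subtopology M (fst c)) = fst c"
  using openin_subset[OF chart_open, of c] by (simp add: topspace_subtopology Int_absorb1)

lemma chart_inj: "c \<in> At \<Longrightarrow> inj_on (snd c) (fst c)"
  using homeomorphic_imp_injective_map[OF chart_homeo] chart_topspace by metis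

lemma pt_chart: "c \<in> At \<Longrightarrow> x \<in> fst c \<Longrightarrow> pt c (snd c x) = x"
  by (rule inv_into_f_f[OF chart_inj])

lemma pt_in: "p \<in> snd c ` fst c \<Longrightarrow> pt c p \<in> fst c"
  by (rule inv_into_into)

lemma chart_pt: "p \<in> snd c ` fst c \<Longrightarrow> snd c (pt c p) = p"
  by (rule f_inv_into_f)

lemma chart_exists: "x \<in> topspace M \<Longrightarrow> \<exists>c\<in>At. x \<in> fst c"
  using manifold by (auto simp: smooth_manifold_def)

lemma chart_in_topspace: "c \<in> At \<Longrightarrow> x \<in> fst c \<Longrightarrow> x \<in> topspace M"
  using openin_subset[OF chart_open] by blast

lemma openin_chart_preimage:
  assumes c: "c \<in> At" and B: "open B"
  shows "openin M {x \<in> fst c. snd c x \<in> B}"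
proof -
  have "continuous_map (subtopology M (fst c)) (top_of_set (snd c ` fst c)) (snd c)"
    by (rule homeomorphic_imp_continuous_map[OF chart_homeo[OF c]])
  then have "continuous_map (subtopology M (fst c)) euclidean (snd c)"
    by (simp add: continuous_map_in_subtopology)
  then have "openin (subtopology M (fst c)) {x \<in> topspace (subtopology M (fst c)). snd c x \<in> B}"
    by (rule openin_continuous_map_preimage) (simp add: B)
  then show ?thesis
    unfolding chart_topspace[OF c] by (rule openin_trans_full[OF _ chart_open[OF c]])
qed

lemma open_chart_overlap:
  assumes c: "c \<in> At" and d: "d \<in> At"
  shows "open (snd c ` (fst c \<inter> fst d))"
proof -
  have "openin (subtopology M (fst c)) (fst c \<inter> fst d)"
    using chart_open[OF d] by (auto simp: openin_subtopology)
  then have "openin (top_of_set (snd c ` fst c)) (snd c ` (fst c \<inter> fst d))"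
    using homeomorphic_imp_open_map[OF chart_homeo[OF c]] unfolding open_map_def by blast
  then show ?thesis using chart_image_open[OF c] openin_open_trans by blast
qed

lemma transition_smooth:
  "c \<in> At \<Longrightarrow> d \<in> At \<Longrightarrow> smooth_on (transition c d) (snd c ` (fst c \<inter> fst d))"
  using manifold by (auto simp: smooth_manifold_def)

lemma transition_differentiable:
  "c \<in> At \<Longrightarrow> d \<in> At \<Longrightarrow> x \<in> fst c \<Longrightarrow> x \<in> fst d \<Longrightarrow> transition c d differentiable (at (snd c x))"
  by (rule smooth_on_differentiable[OF transition_smooth]) auto

lemma transition_chart: "c \<in> At \<Longrightarrow> x \<in> fst c \<Longrightarrow> transition c d (snd c x) = snd d x"
  by (simp add: transition_def pt_chart)

lemma D_transition_self:
  assumes "c \<in> At" "x \<in> fst c"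
  shows "D (transition c c) (snd c x) w = w"
proof -
  have "D (\<lambda>p. p) (snd c x) w = D (transition c c) (snd c x) w"
    by (rule D_cong_open[OF chart_image_open[OF assms(1)]])
       (use assms in \<open>auto simp: transition_chart\<close>)
  then show ?thesis by simp
qed

lemma D_transition_compose:
  assumes At: "c \<in> At" "d \<in> At" "e \<in> At" and x: "x \<in> fst c" "x \<in> fst d" "x \<in> fst e"
  shows "D (transition d e) (snd d x) (D (transition c d) (snd c x) w) = D (transition c e) (snd c x) w"
proof -
  let ?O = "snd c ` (fst c \<inter> fst d)"
  have 1: "(transition c d has_derivative D (transition c d) (snd c x)) (at (snd c x))"
    by (rule has_derivative_D[OF transition_differentiable[OF At(1,2) x(1,2)]])
  have "D (\<lambda>p. transition d e (transition c d p)) (snd c x) w = D (transition c e) (snd c x) w"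
    by (rule D_cong_open[OF open_chart_overlap[OF At(1,2)]])
       (use At x in \<open>auto simp: transition_chart\<close>)
  moreover have "D (\<lambda>p. transition d e (transition c d p)) (snd c x) w
      = D (transition d e) (transition c d (snd c x)) (D (transition c d) (snd c x) w)"
    by (rule D_eq[OF has_derivative_chain[OF 1]])
       (use At x transition_differentiable in \<open>simp add: transition_chart\<close>)
  ultimately show ?thesis by (simp add: transition_chart At x)
qed

lemma vec_at_component: "c \<in> At \<Longrightarrow> x \<in> fst c \<Longrightarrow> vec_at At c x w c = w"
  by (simp add: vec_at_def D_transition_self)

lemma vec_at_other:
  "d \<in> At \<Longrightarrow> x \<in> fst d \<Longrightarrow> vec_at At c x w d = D (transition c d) (snd c x) w"
  by (simp add: vec_at_def)

lemma vec_at_tangent: "c \<in> At \<Longrightarrow> x \<in> fst c \<Longrightarrow> vec_at At c x w \<in> tangent_space At x"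
  by (auto simp: tangent_space_def vec_at_def D_transition_compose)

lemma tangent_eq_vec_at:
  assumes c: "c \<in> At" "x \<in> fst c" and v: "v \<in> tangent_space At x"
  shows "v = vec_at At c x (v c)"
proof
  fix d
  have "v d = D (transition c d) (snd c x) (v c)" if "d \<in> At" "x \<in> fst d"
    using c v that unfolding tangent_space_def by blast
  moreover have "v d = 0" if "\<not> (d \<in> At \<and> x \<in> fst d)"
    using v that unfolding tangent_space_def by blast
  ultimately show "v d = vec_at At c x (v c) d" by (simp add: vec_at_def)
qed

lemma vec_at_change_chart:
  "c \<in> At \<Longrightarrow> d \<in> At \<Longrightarrow> x \<in> fst c \<Longrightarrow> x \<in> fst d \<Longrightarrow>
    vec_at At d x (D (transition c d) (snd c x) w) = vec_at At c x w"
  using tangent_eq_vec_at[of d x "vec_at At c x w"] by (simp add: vec_at_tangent vec_at_other)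

lemma vec_at_add: "c \<in> At \<Longrightarrow> x \<in> fst c \<Longrightarrow> vec_at At c x (u + v) = tadd (vec_at At c x u) (vec_at At c x v)"
  by (rule ext) (simp add: vec_at_def tadd_def
      linear_add[OF linear_frechet_derivative[OF transition_differentiable]])

lemma vec_at_scale: "c \<in> At \<Longrightarrow> x \<in> fst c \<Longrightarrow> vec_at At c x (a *\<^sub>R v) = tscale a (vec_at At c x v)"
  by (rule ext) (simp add: vec_at_def tscale_def
      linear_scale[OF linear_frechet_derivative[OF transition_differentiable]])

lemma nat_coords_inj: "c \<in> At \<Longrightarrow> inj_on (nat_coords c) (tangent_bundle At (fst c))"
proof (rule inj_onI, clarify)
  fix x v y w assume c: "c \<in> At" and xv: "(x, v) \<in> tangent_bundle At (fst c)"
    and yw: "(y, w) \<in> tangent_bundle At (fst c)" and eq: "nat_coords c (x, v) = nat_coords c (y, w)"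
  have "x = y" "v c = w c"
    using eq xv yw chart_inj[OF c] by (auto simp: nat_coords_def tangent_bundle_def inj_on_def)
  moreover have "v = vec_at At c x (v c)" "w = vec_at At c y (w c)"
    using xv yw by (auto simp: tangent_bundle_def intro: tangent_eq_vec_at[OF c])
  ultimately show "x = y \<and> v = w" by metis
qed

lemma nat_coords_inv_nat_coords:
  "c \<in> At \<Longrightarrow> z \<in> tangent_bundle At (fst c) \<Longrightarrow> nat_coords_inv At c (nat_coords c z) = z"
  unfolding nat_coords_inv_def by (rule inv_into_f_f[OF nat_coords_inj])

lemma nat_coords_vec_at: "c \<in> At \<Longrightarrow> x \<in> fst c \<Longrightarrow> nat_coords c (x, vec_at At c x w) = (snd c x, w)"
  by (simp add: nat_coords_def vec_at_component)

lemma nat_coords_inv_vec_at: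
  assumes c: "c \<in> At" and x: "x \<in> fst c"
  shows "nat_coords_inv At c (snd c x, w) = (x, vec_at At c x w)"
  using nat_coords_inv_nat_coords[OF c, of "(x, vec_at At c x w)"]
  by (simp add: nat_coords_vec_at c x tangent_bundle_def vec_at_tangent)

lemma coord_vec_eq: "c \<in> At \<Longrightarrow> x \<in> fst c \<Longrightarrow> coord_vec At c (snd c x) w = vec_at At c x w"
  by (simp add: coord_vec_def nat_coords_inv_vec_at)

lemma coord_rep_vec_at:
  "c \<in> At \<Longrightarrow> x \<in> fst c \<Longrightarrow> coord_rep At c f (snd c x, w) = f (x, vec_at At c x w)"
  by (simp add: coord_rep_def nat_coords_inv_vec_at)

lemma coord_image_iff:
  assumes c: "c \<in> At" and x: "x \<in> fst c"
  shows "(snd c x, w) \<in> coord_image At c A \<longleftrightarrow> (x, vec_at At c x w) \<in> A"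
proof
  assume "(snd c x, w) \<in> coord_image At c A"
  then obtain y v where z: "(y, v) \<in> A" "y \<in> fst c" "v \<in> tangent_space At y" "snd c y = snd c x" "v c = w"
    by (auto simp: coord_image_def nat_coords_def tangent_bundle_def)
  then have "y = x" using chart_inj[OF c] x by (auto simp: inj_on_def)
  then show "(x, vec_at At c x w) \<in> A" using z tangent_eq_vec_at[OF c x, of v] by simp
next
  assume "(x, vec_at At c x w) \<in> A"
  then show "(snd c x, w) \<in> coord_image At c A"
    using c x unfolding coord_image_def
    by (intro image_eqI[of _ _ "(x, vec_at At c x w)"])
       (auto simp: nat_coords_vec_at tangent_bundle_def vec_at_tangent)
qed

lemma openin_by_charts:
  assumes "S \<subseteq> topspace M"
    and "\<And>c x. c \<in> At \<Longrightarrow> x \<in> fst c \<Longrightarrow> x \<in> S \<Longrightarrow>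
      \<exists>B. open B \<and> snd c x \<in> B \<and> B \<subseteq> snd c ` fst c \<and> (\<forall>p\<in>B. pt c p \<in> S)"
  shows "openin M S"
proof (subst openin_subopen, intro ballI)
  fix x assume x: "x \<in> S"
  then obtain c where c: "c \<in> At" "x \<in> fst c" using assms(1) chart_exists by blast
  obtain B where B: "open B" "snd c x \<in> B" "\<And>p. p \<in> B \<Longrightarrow> pt c p \<in> S"
    using assms(2)[OF c x] by blast
  have "{y \<in> fst c. snd c y \<in> B} \<subseteq> S" using B(3) pt_chart[OF c(1)] by force
  then show "\<exists>T. openin M T \<and> x \<in> T \<and> T \<subseteq> S"
    using openin_chart_preimage[OF c(1) B(1)] B(2) c(2) by blast
qed

definition local_form :: "('m, 'n) cov2 \<Rightarrow> ('m, 'n) chart \<Rightarrow> real^'n \<Rightarrow> real^'n \<Rightarrow> real^'n \<Rightarrow> real" where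
  "local_form h c p u v = h (pt c p) (vec_at At c (pt c p) u) (vec_at At c (pt c p) v)"

lemma local_form_bilinear:
  assumes h: "cov2_tensor_field M At h" and c: "c \<in> At" and p: "p \<in> snd c ` fst c"
  shows "bilinear (local_form h c p)"
proof -
  have x: "pt c p \<in> fst c" "pt c p \<in> topspace M" using pt_in[OF p] chart_in_topspace[OF c] by auto
  let ?v = "vec_at At c (pt c p)"
  have t: "?v u \<in> tangent_space At (pt c p)" for u by (rule vec_at_tangent[OF c x(1)])
  have "h (pt c p) (tadd (?v u) (?v v)) (?v w) = h (pt c p) (?v u) (?v w) + h (pt c p) (?v v) (?v w)"
    "h (pt c p) (?v w) (tadd (?v u) (?v v)) = h (pt c p) (?v w) (?v u) + h (pt c p) (?v w) (?v v)"
    "h (pt c p) (tscale a (?v u)) (?v w) = a * h (pt c p) (?v u) (?v w)"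
    "h (pt c p) (?v w) (tscale a (?v u)) = a * h (pt c p) (?v w) (?v u)" for u v w a
    using h x(2) t unfolding cov2_tensor_field_def by blast+
  then show ?thesis
    unfolding bilinear_def by (auto intro!: linearI simp: local_form_def vec_at_add vec_at_scale c x)
qed

lemma local_form_tensor_comp:
  assumes "c \<in> At" "p \<in> snd c ` fst c"
  shows "tensor_comp At c h i j p = local_form h c p (axis i 1) (axis j 1)"
  using coord_vec_eq[OF assms(1) pt_in[OF assms(2)]]
  by (simp add: tensor_comp_def local_form_def chart_pt[OF assms(2)])

lemma local_form_smooth:
  assumes h: "cov2_tensor_field M At h" and c: "c \<in> At"
  shows "smooth_on (\<lambda>p. local_form h c p u v) (snd c ` fst c)"
proof -
  note S = chart_image_open[OF c]
  have b: "linear (local_form h c p w)" "linear (\<lambda>u. local_form h c p u w)" if "p \<in> snd c ` fst c" for p w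
    using local_form_bilinear[OF h c that] by (auto simp: bilinear_def)
  have e: "smooth_on (\<lambda>p. local_form h c p (axis i 1) (axis j 1)) (snd c ` fst c)" for i j
  proof (rule smooth_on_cong[OF _ S])
    show "smooth_on (tensor_comp At c h i j) (snd c ` fst c)"
      using h c by (simp add: cov2_tensor_field_def)
  qed (rule local_form_tensor_comp[OF c])
  have e2: "smooth_on (\<lambda>p. local_form h c p (axis i 1) v) (snd c ` fst c)" for i
  proof (rule smooth_on_cong[OF _ S])
    show "smooth_on (\<lambda>p. \<Sum>j\<in>UNIV. v $ j *\<^sub>R local_form h c p (axis i 1) (axis j 1)) (snd c ` fst c)"
      by (rule smooth_on_sum[OF smooth_on_scaleR[OF smooth_on_const e S] S])
  qed (rule linear_expand[OF b(1), symmetric])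
  show ?thesis
  proof (rule smooth_on_cong[OF _ S])
    show "smooth_on (\<lambda>p. \<Sum>i\<in>UNIV. u $ i *\<^sub>R local_form h c p (axis i 1) v) (snd c ` fst c)"
      by (rule smooth_on_sum[OF smooth_on_scaleR[OF smooth_on_const e2 S] S])
  qed (rule linear_expand[OF b(2), symmetric])
qed

text \<open>
  Covers the symmetrisation of a tensor field as well as its rescaling by a constant.
\<close>

lemma cov2_tensor_field_combination:
  assumes h: "cov2_tensor_field M At h"
  shows "cov2_tensor_field M At (\<lambda>x v w. a * h x v w + b * h x w v)"
  unfolding cov2_tensor_field_def
proof (intro conjI ballI allI)
  fix x u v w s
  assume t: "x \<in> topspace M" "u \<in> tangent_space At x" "v \<in> tangent_space At x" "w \<in> tangent_space At x"
  have H: "h x (tadd u v) w = h x u w + h x v w" "h x w (tadd u v) = h x w u + h x w v"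
      "h x (tscale s u) w = s * h x u w" "h x w (tscale s u) = s * h x w u"
    using h t unfolding cov2_tensor_field_def by blast+
  show "a * h x (tadd u v) w + b * h x w (tadd u v) = a * h x u w + b * h x w u + (a * h x v w + b * h x w v)"
    "a * h x w (tadd u v) + b * h x (tadd u v) w = a * h x w u + b * h x u w + (a * h x w v + b * h x v w)"
    "a * h x (tscale s u) w + b * h x w (tscale s u) = s * (a * h x u w + b * h x w u)"
    "a * h x w (tscale s u) + b * h x (tscale s u) w = s * (a * h x w u + b * h x u w)"
    by (simp_all add: H algebra_simps)
next
  fix c i j assume c: "c \<in> At"
  have "smooth_on (\<lambda>p. a * tensor_comp At c h i j p + b * tensor_comp At c h j i p) (snd c ` fst c)"
    using h c chart_image_open[OF c]
    by (intro smooth_on_add smooth_on_mult smooth_on_const) (auto simp: cov2_tensor_field_def)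
  then show "smooth_on (tensor_comp At c (\<lambda>x v w. a * h x v w + b * h x w v) i j) (snd c ` fst c)"
    by (rule smooth_on_cong[OF _ chart_image_open[OF c]]) (simp add: tensor_comp_def)
qed

end

section \<open>Einstein metrics with quadratic Ricci scalar\<close>

text \<open>
  The tensor \<open>h\<close> can be taken symmetric since only its values on the diagonal matter.
\<close>

locale einstein_quadratic = manifold M At
  for M :: "'m topology" and At :: "('m, 'n::finite) chart set" +
  fixes A :: "('m \<times> ('m, 'n) tvec) set" and L :: "'m \<times> ('m, 'n) tvec \<Rightarrow> real"
    and h :: "('m, 'n) cov2" and \<rho> :: "'m \<Rightarrow> real"
  assumes A_tangent: "(x, v) \<in> A \<Longrightarrow> x \<in> topspace M \<and> v \<in> tangent_space At x"
    and A_open: "open_in_bundle At A"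
    and A_onto: "fst ` A = topspace M"
    and finsler: "pseudo_finsler At A L"
    and h_tensor: "cov2_tensor_field M At h"
    and h_sym: "h x v w = h x w v"
    and \<rho>_smooth: "smooth_fun At \<rho>"
    and ricci_h: "(x, v) \<in> A \<Longrightarrow> ricci_scalar At L (x, v) = h x v v"
    and ricci_\<rho>: "(x, v) \<in> A \<Longrightarrow> ricci_scalar At L (x, v) = \<rho> x * L (x, v)"
begin

text \<open>
  The part of the coordinate domain on which \<open>\<rho> L = h\<close> can be solved for \<open>L\<close>, and the metric \<open>h/\<rho>\<close> there.
\<close>

definition nonflat_region :: "('m, 'n) chart \<Rightarrow> (real^'n) set" where
  "nonflat_region c = {p \<in> snd c ` fst c. \<rho> (pt c p) \<noteq> 0}"

definition metric :: "('m, 'n) chart \<Rightarrow> real^'n \<Rightarrow> real^'n \<Rightarrow> real^'n \<Rightarrow> real" where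
  "metric c p u v = local_form h c p u v * inverse (\<rho> (pt c p))"

lemma \<rho>_chart_smooth: "c \<in> At \<Longrightarrow> smooth_on (\<lambda>p. \<rho> (pt c p)) (snd c ` fst c)"
  using \<rho>_smooth by (auto simp: smooth_fun_def o_def)

lemma nonflat_region_subset: "nonflat_region c \<subseteq> snd c ` fst c"
  by (auto simp: nonflat_region_def)

lemma nonflat_region_open: assumes c: "c \<in> At" shows "open (nonflat_region c)"
proof -
  have "open ((\<lambda>p. \<rho> (pt c p)) -` (- {0}) \<inter> snd c ` fst c)"
    using smooth_on_continuous[OF \<rho>_chart_smooth[OF c]]
      continuous_on_open_vimage[OF chart_image_open[OF c]] by blast
  moreover have "nonflat_region c = (\<lambda>p. \<rho> (pt c p)) -` (- {0}) \<inter> snd c ` fst c"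
    by (auto simp: nonflat_region_def)
  ultimately show ?thesis by simp
qed

lemma L_eq: "(x, v) \<in> A \<Longrightarrow> \<rho> x \<noteq> 0 \<Longrightarrow> L (x, v) = h x v v * inverse (\<rho> x)"
  using ricci_h[of x v] ricci_\<rho>[of x v] by (simp add: field_simps)

definition nonflat_bundle :: "('m, 'n) chart \<Rightarrow> ((real^'n) \<times> (real^'n)) set" where
  "nonflat_bundle c = coord_image At c A \<inter> fst -` nonflat_region c"

lemma nonflat_bundle_open: "c \<in> At \<Longrightarrow> open (nonflat_bundle c)"
  unfolding nonflat_bundle_def using A_open nonflat_region_open[of c]
  by (auto simp: open_in_bundle_def intro!: open_Int open_vimage_fst)

lemma nonflat_bundle_base: "fst ` nonflat_bundle c \<subseteq> nonflat_region c"
  by (auto simp: nonflat_bundle_def)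

lemma coord_rep_eq_metric:
  assumes c: "c \<in> At" and z: "z \<in> nonflat_bundle c"
  shows "metric c (fst z) (snd z) (snd z) = coord_rep At c L z"
proof -
  obtain p w where pw: "z = (p, w)" by (cases z)
  have p: "p \<in> snd c ` fst c" "\<rho> (pt c p) \<noteq> 0"
    using z by (auto simp: nonflat_bundle_def nonflat_region_def pw)
  have "(pt c p, vec_at At c (pt c p) w) \<in> A"
    using z coord_image_iff[OF c pt_in[OF p(1)], of w A] by (simp add: nonflat_bundle_def pw chart_pt[OF p(1)])
  then show ?thesis
    using coord_rep_vec_at[OF c pt_in[OF p(1)], of L w] p
    by (simp add: pw metric_def local_form_def L_eq chart_pt)
qed

lemma fibre_exists:
  assumes c: "c \<in> At" and p: "p \<in> nonflat_region c"
  obtains w where "(p, w) \<in> nonflat_bundle c"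
proof -
  have p': "p \<in> snd c ` fst c" using p by (auto simp: nonflat_region_def)
  have "pt c p \<in> fst ` A" using chart_in_topspace[OF c pt_in[OF p']] A_onto by simp
  then obtain v where v: "(pt c p, v) \<in> A" by auto
  then have "v = vec_at At c (pt c p) (v c)"
    using tangent_eq_vec_at[OF c pt_in[OF p']] A_tangent by blast
  then have "(p, v c) \<in> coord_image At c A"
    using coord_image_iff[OF c pt_in[OF p'], of "v c" A] v by (simp add: chart_pt[OF p'])
  then show ?thesis using p by (intro that) (auto simp: nonflat_bundle_def)
qed

lemma metric_bilinear:
  assumes c: "c \<in> At" and p: "p \<in> snd c ` fst c"
  shows "bilinear (metric c p)"
  using local_form_bilinear[OF h_tensor c p]
  by (auto simp: bilinear_def metric_def linear_iff algebra_simps)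

lemma metric_sym: "metric c p u v = metric c p v u"
  by (simp add: metric_def local_form_def h_sym[of _ "vec_at At c (pt c p) u"])

lemma metric_smooth: "c \<in> At \<Longrightarrow> smooth_on (\<lambda>p. metric c p u v) (nonflat_region c)"
  unfolding metric_def
  by (intro smooth_on_mult smooth_on_inverse nonflat_region_open
      smooth_on_subset[OF local_form_smooth[OF h_tensor] nonflat_region_subset]
      smooth_on_subset[OF \<rho>_chart_smooth nonflat_region_subset]) (auto simp: nonflat_region_def)

text \<open>
  The fundamental tensor at any vector of \<open>A\<close> over the given point is the Gram matrix of the metric.
\<close>

lemma metric_nondegenerate:
  assumes c: "c \<in> At" and p: "p \<in> nonflat_region c"
  shows "nondegenerate (metric c p)"
proof -
  obtain w where w: "(p, w) \<in> nonflat_bundle c" using fibre_exists[OF c p] .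
  have "fund_tensor (coord_rep At c L) (p, w) = gram (metric c (fst (p, w)))"
    by (rule fund_tensor_quadratic[OF nonflat_bundle_open[OF c] nonflat_region_open[OF c] nonflat_bundle_base
          coord_rep_eq_metric[OF c] metric_bilinear[OF c] metric_sym
          smooth_on_differentiable[OF metric_smooth[OF c]] w])
       (use nonflat_region_subset[of c] in auto)
  moreover have "invertible (fund_tensor (coord_rep At c L) (p, w))"
    using finsler c w by (auto simp: pseudo_finsler_def nonflat_bundle_def)
  moreover have "bilinear (metric c p)"
    using metric_bilinear[OF c] p nonflat_region_subset by blast
  ultimately show ?thesis using invertible_gram_iff metric_sym by fastforce
qed

lemma metric_local: "c \<in> At \<Longrightarrow> local_metric (nonflat_region c) (metric c)"
  using nonflat_region_subset[of c]
  by (intro local_metric.intro nonflat_region_open metric_bilinear metric_sym metric_nondegenerate metric_smooth) auto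

lemma ricci_coord_eq:
  "c \<in> At \<Longrightarrow> z \<in> nonflat_bundle c \<Longrightarrow>
    ricci_coord (coord_rep At c L) z = ricci (metric c) (fst z) (snd z) (snd z)"
  by (rule local_metric.ricci_coord_quadratic[OF metric_local nonflat_bundle_open nonflat_bundle_base coord_rep_eq_metric])

text \<open>
  The transition map pulls one local metric back to the other, as both are \<open>h/\<rho>\<close> on the
  same tangent vectors.
\<close>

lemma ricci_chart_independent:
  assumes c: "c \<in> At" and d: "d \<in> At" and x: "x \<in> fst c" "x \<in> fst d" and r: "\<rho> x \<noteq> 0"
  shows "ricci (metric c) (snd c x) u v =
    ricci (metric d) (snd d x) (D (transition c d) (snd c x) u) (D (transition c d) (snd c x) v)"
proof -
  let ?O = "snd c ` (fst c \<inter> fst d)" and ?\<phi> = "transition c d"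
  let ?V = "?O \<inter> nonflat_region c"
  have V: "open ?V" using open_chart_overlap[OF c d] nonflat_region_open[OF c] by blast
  have in_V: "\<exists>y. y \<in> fst c \<and> y \<in> fst d \<and> \<rho> y \<noteq> 0 \<and> p = snd c y" if pV: "p \<in> ?V" for p
  proof -
    obtain y where "y \<in> fst c" "y \<in> fst d" "p = snd c y" using pV by blast
    then show ?thesis using pV pt_chart[OF c, of y] by (auto simp: nonflat_region_def)
  qed
  have "metric_pullback ?V (metric c) (nonflat_region d) (metric d) ?\<phi>"
  proof (intro metric_pullback.intro metric_pullback_axioms.intro)
    show "local_metric ?V (metric c)"
      by (rule local_metric_subset[OF metric_local[OF c] V]) auto
    show "local_metric (nonflat_region d) (metric d)" by (rule metric_local[OF d])
    show "smooth_on ?\<phi> ?V" by (rule smooth_on_subset[OF transition_smooth[OF c d]]) auto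
    fix p u v assume "p \<in> ?V"
    then obtain y where y: "y \<in> fst c" "y \<in> fst d" "\<rho> y \<noteq> 0" "p = snd c y"
      using in_V by blast
    show "?\<phi> p \<in> nonflat_region d"
      using y by (simp add: nonflat_region_def transition_chart c d pt_chart)
    show "metric c p u v = metric d (?\<phi> p) (D ?\<phi> p u) (D ?\<phi> p v)"
      using y by (simp add: metric_def local_form_def transition_chart c d pt_chart vec_at_change_chart)
  qed
  from metric_pullback.ricci_pullback[OF this, of "snd c x" u v] show ?thesis
    using c d x r by (simp add: nonflat_region_def transition_chart pt_chart)
qed

lemma einstein_on_fibre:
  assumes c: "c \<in> At" and z: "(p, w) \<in> nonflat_bundle c"
  shows "ricci (metric c) p w w = \<rho> (pt c p) * metric c p w w"
proof -
  have p: "p \<in> snd c ` fst c" and r: "\<rho> (pt c p) \<noteq> 0"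
    using z by (auto simp: nonflat_bundle_def nonflat_region_def)
  define x where "x = pt c p"
  define v where "v = vec_at At c x w"
  have x: "x \<in> fst c" "snd c x = p" using pt_in[OF p] chart_pt[OF p] by (auto simp: x_def)
  have A: "(x, v) \<in> A"
    using coord_image_iff[OF c x(1), of w A] z x(2) by (simp add: v_def nonflat_bundle_def)
  \<comment> \<open>the chart in which the Ricci scalar at this vector is computed\<close>
  define d where "d = (SOME d. d \<in> At \<and> fst (x, v) \<in> fst d)"
  have "d \<in> At \<and> fst (x, v) \<in> fst d"
    unfolding d_def by (rule someI[of _ c]) (use c x in simp)
  then have d: "d \<in> At" "x \<in> fst d" by auto
  have vd: "v d = D (transition c d) (snd c x) w" by (simp add: v_def vec_at_other d)
  have "vec_at At d x (v d) = v"
    unfolding vd unfolding v_def by (rule vec_at_change_chart[OF c d(1) x(1) d(2)])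
  then have win: "(snd d x, v d) \<in> nonflat_bundle d"
    using coord_image_iff[OF d, of "v d" A] A r d
    by (simp add: nonflat_bundle_def nonflat_region_def pt_chart x_def)
  have "\<rho> x * L (x, v) = ricci_coord (coord_rep At d L) (nat_coords d (x, v))"
    using ricci_\<rho>[OF A] by (simp add: ricci_scalar_def Let_def d_def)
  also have "\<dots> = ricci (metric d) (snd d x) (v d) (v d)"
    using ricci_coord_eq[OF d(1) win] by (simp add: nat_coords_def)
  also have "\<dots> = ricci (metric c) p w w"
    using ricci_chart_independent[OF c d(1) x(1) d(2), of w w] r by (simp add: vd x(2)) (simp add: x_def)
  finally have "ricci (metric c) p w w = \<rho> x * L (x, v)" by simp
  also have "L (x, v) = metric c p w w"
    using L_eq[OF A] r by (simp add: metric_def local_form_def v_def x_def)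
  finally show ?thesis by (simp add: x_def)
qed

text \<open>
  On the open set of those \<open>w\<close> with \<open>(p, w)\<close> in the domain of \<open>L\<close> the equation holds for \<open>u = v = w\<close>;
  both sides are symmetric bilinear forms, so that is enough.
\<close>

lemma einstein_metric:
  assumes c: "c \<in> At" and p: "p \<in> nonflat_region c"
  shows "ricci (metric c) p u v = \<rho> (pt c p) * metric c p u v"
proof -
  interpret local_metric "nonflat_region c" "metric c" by (rule metric_local[OF c])
  let ?B = "\<lambda>u v. ricci (metric c) p u v - \<rho> (pt c p) * metric c p u v"
  obtain w where w: "(p, w) \<in> nonflat_bundle c" using fibre_exists[OF c p] .
  have "bilinear ?B"
    using ricci_bilinear[OF p] g_bilinear[OF p] by (auto simp: bilinear_def linear_iff algebra_simps)
  moreover have "?B u v = ?B v u" for u v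
    using ricci_sym[OF p, of u v] metric_sym[of c p u v] by simp
  moreover have "open {w. (p, w) \<in> nonflat_bundle c}"
    using open_vimage[OF nonflat_bundle_open[OF c], of "Pair p"]
    by (simp add: vimage_def continuous_on_Pair)
  ultimately have "?B u v = 0"
    by (rule quadratic_form_zero_on_open[where y = w]) (use w einstein_on_fibre[OF c] in auto)
  then show ?thesis by simp
qed

lemma D_\<rho>_zero:
  assumes n: "CARD('n) \<ge> 3" and c: "c \<in> At" and p: "p \<in> nonflat_region c"
  shows "D (\<lambda>p. \<rho> (pt c p)) p a = 0"
proof (rule local_metric.schur[OF metric_local[OF c] _ einstein_metric[OF c] n p])
  show "(\<lambda>p. \<rho> (pt c p)) differentiable (at p)" if "p \<in> nonflat_region c" for p
    using smooth_on_differentiable[OF \<rho>_chart_smooth[OF c]] that nonflat_region_subset by blast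
qed

lemma openin_\<rho>_avoids: "openin M {x \<in> topspace M. \<rho> x \<noteq> k}"
proof (rule openin_by_charts)
  fix c x assume c: "c \<in> At" "x \<in> fst c" and x: "x \<in> {x \<in> topspace M. \<rho> x \<noteq> k}"
  let ?B = "(\<lambda>p. \<rho> (pt c p)) -` (- {k}) \<inter> snd c ` fst c"
  have "open ?B"
    using smooth_on_continuous[OF \<rho>_chart_smooth[OF c(1)]]
      continuous_on_open_vimage[OF chart_image_open[OF c(1)]] by blast
  then show "\<exists>B. open B \<and> snd c x \<in> B \<and> B \<subseteq> snd c ` fst c \<and> (\<forall>p\<in>B. pt c p \<in> {x \<in> topspace M. \<rho> x \<noteq> k})"
    using c x pt_in chart_in_topspace[OF c(1)] by (intro exI[of _ ?B]) (auto simp: pt_chart)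
qed auto

text \<open>
  On a small coordinate ball around a point where \<open>\<rho> \<noteq> 0\<close>, Schur's lemma makes \<open>\<rho>\<close> constant.
\<close>

lemma openin_\<rho>_level:
  assumes n: "CARD('n) \<ge> 3" and k: "k \<noteq> 0"
  shows "openin M {x \<in> topspace M. \<rho> x = k}"
proof (rule openin_by_charts)
  fix c x assume c: "c \<in> At" "x \<in> fst c" and x: "x \<in> {x \<in> topspace M. \<rho> x = k}"
  have "snd c x \<in> nonflat_region c" using c x k by (simp add: nonflat_region_def pt_chart)
  then obtain e where e: "e > 0" "ball (snd c x) e \<subseteq> nonflat_region c"
    using nonflat_region_open[OF c(1)] openE by blast
  let ?f = "\<lambda>p. \<rho> (pt c p)"
  have "\<exists>k. \<forall>p\<in>ball (snd c x) e. ?f p = k"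
  proof (rule has_derivative_zero_constant)
    fix p assume p: "p \<in> ball (snd c x) e"
    then have "p \<in> nonflat_region c" using e by blast
    then have "(?f has_derivative D ?f p) (at p)"
      using smooth_on_differentiable[OF \<rho>_chart_smooth[OF c(1)]] nonflat_region_subset
      by (blast intro: has_derivative_D)
    then show "(?f has_derivative (\<lambda>a. 0)) (at p within ball (snd c x) e)"
    proof -
      have "D ?f p = (\<lambda>a. 0)" using D_\<rho>_zero[OF n c(1) \<open>p \<in> nonflat_region c\<close>] by (rule ext)
      with \<open>(?f has_derivative D ?f p) (at p)\<close> show ?thesis by (simp add: has_derivative_at_withinI)
    qed
  qed simp
  then have "\<forall>p\<in>ball (snd c x) e. ?f p = k"
    using x c e(1) by (metis (mono_tags) centre_in_ball mem_Collect_eq pt_chart)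
  moreover have "pt c p \<in> topspace M" if "p \<in> ball (snd c x) e" for p
    using chart_in_topspace[OF c(1) pt_in] that e(2) nonflat_region_subset[of c] by blast
  ultimately show "\<exists>B. open B \<and> snd c x \<in> B \<and> B \<subseteq> snd c ` fst c \<and>
      (\<forall>p\<in>B. pt c p \<in> {x \<in> topspace M. \<rho> x = k})"
    using e nonflat_region_subset[of c] by (intro exI[of _ "ball (snd c x) e"]) auto
qed auto

text \<open>
  The level set through \<open>x\<close> is open by Schur's lemma and closed by continuity.
\<close>

lemma \<rho>_constant:
  assumes n: "CARD('n) \<ge> 3" and conn: "connected_space M"
    and x: "x \<in> topspace M" "\<rho> x \<noteq> 0" and y: "y \<in> topspace M"
  shows "\<rho> y = \<rho> x"
proof -
  let ?S = "{y \<in> topspace M. \<rho> y = \<rho> x}"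
  have "topspace M - ?S = {y \<in> topspace M. \<rho> y \<noteq> \<rho> x}" by auto
  then have "closedin M ?S" using openin_\<rho>_avoids[of "\<rho> x"] by (auto simp: closedin_def)
  then have "?S = {} \<or> ?S = topspace M"
    using conn openin_\<rho>_level[OF n x(2)] unfolding connected_space_clopen_in by blast
  then show ?thesis using x y by blast
qed

lemma pseudo_riemannian:
  assumes k: "k \<noteq> 0" and \<rho>: "\<And>x. x \<in> topspace M \<Longrightarrow> \<rho> x = k"
  shows "pseudo_riemannian_metric M At (\<lambda>x v w. inverse k * h x v w)"
  unfolding pseudo_riemannian_metric_def
proof (intro conjI ballI impI)
  show "cov2_tensor_field M At (\<lambda>x v w. inverse k * h x v w)"
    using cov2_tensor_field_combination[OF h_tensor, of "inverse k" 0] by simp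
  show "inverse k * h x v w = inverse k * h x w v" for x v w
    using h_sym[of x v w] by simp
  fix x v assume x: "x \<in> topspace M" and v: "v \<in> tangent_space At x"
    and z: "\<forall>w\<in>tangent_space At x. inverse k * h x v w = 0"
  obtain c where c: "c \<in> At" "x \<in> fst c" using chart_exists[OF x] by blast
  have reg: "snd c x \<in> nonflat_region c" using c x k \<rho> by (simp add: nonflat_region_def pt_chart)
  have v': "v = vec_at At c x (v c)" by (rule tangent_eq_vec_at[OF c v])
  have "metric c (snd c x) (v c) w = 0" for w
    using z vec_at_tangent[OF c, of w] v' k by (simp add: metric_def local_form_def pt_chart c)
  then have "v c = 0" using metric_nondegenerate[OF c(1) reg] unfolding nondegenerate_def by blast
  then show "v = tzero"
    using v' vec_at_scale[OF c, of 0 0] by (simp add: tscale_def tzero_def)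
qed

end

theorem theorem4p4:
  fixes M :: "'m topology"
    and At :: "('m, 'n::finite) chart set"
    and A :: "('m \<times> ('m, 'n) tvec) set"
    and L :: "'m \<times> ('m, 'n) tvec \<Rightarrow> real"
  assumes "smooth_manifold M At"
    and "connected_space M"
    and "CARD('n) \<ge> 3"
    and "A \<subseteq> slit_tangent_bundle At (topspace M)"
    and "open_in_bundle At A"
    and "conic_subset A"
    and "fst ` A = topspace M"
    and "pseudo_finsler At A L"
    and "quadratic M At A (ricci_scalar At L)"
    and "einstein At A L"
  shows "(\<forall>z\<in>A. ricci_scalar At L z = 0) \<or>
    ((\<exists>h. pseudo_riemannian_metric M At h \<and> (\<forall>(x, v)\<in>A. L (x, v) = h x v v)) \<and>
     (\<exists>c. \<forall>z\<in>A. ricci_scalar At L z = c * L z))"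
proof -
  interpret manifold M At by (rule manifold.intro) fact
  obtain h where h: "cov2_tensor_field M At h" "\<forall>(x, v)\<in>A. ricci_scalar At L (x, v) = h x v v"
    using assms(9) by (auto simp: quadratic_def)
  obtain \<rho> where \<rho>: "smooth_fun At \<rho>" "\<forall>(x, v)\<in>A. ricci_scalar At L (x, v) = \<rho> x * L (x, v)"
    using assms(10) by (auto simp: einstein_def)
  define h' where "h' = (\<lambda>x v w. 1/2 * h x v w + 1/2 * h x w v)"
  interpret einstein_quadratic M At A L h' \<rho>
  proof
    show "x \<in> topspace M \<and> v \<in> tangent_space At x" if "(x, v) \<in> A" for x v
      using assms(4) that by (auto simp: slit_tangent_bundle_def tangent_bundle_def)
    show "cov2_tensor_field M At h'"
      unfolding h'_def by (rule cov2_tensor_field_combination[OF h(1)])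
    show "ricci_scalar At L (x, v) = h' x v v" if "(x, v) \<in> A" for x v
      using h(2) that by (auto simp: h'_def)
    show "ricci_scalar At L (x, v) = \<rho> x * L (x, v)" if "(x, v) \<in> A" for x v
      using \<rho>(2) that by auto
  qed (use assms \<rho> in \<open>auto simp: h'_def\<close>)
  show ?thesis
  proof (cases "\<forall>x\<in>topspace M. \<rho> x = 0")
    case True
    then have "ricci_scalar At L z = 0" if "z \<in> A" for z
      using that A_tangent[of "fst z" "snd z"] ricci_\<rho>[of "fst z" "snd z"] by simp
    then show ?thesis by blast
  next
    case False
    then obtain x0 where x0: "x0 \<in> topspace M" "\<rho> x0 \<noteq> 0" by blast
    have \<rho>k: "\<rho> x = \<rho> x0" if "x \<in> topspace M" for x
      by (rule \<rho>_constant[OF assms(3,2) x0 that])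
    have "pseudo_riemannian_metric M At (\<lambda>x v w. inverse (\<rho> x0) * h' x v w)"
      by (rule pseudo_riemannian[OF x0(2) \<rho>k])
    moreover have "L (x, v) = inverse (\<rho> x0) * h' x v v" if "(x, v) \<in> A" for x v
      using L_eq[OF that] \<rho>k[of x] x0(2) A_tangent[OF that] by simp
    moreover have "ricci_scalar At L z = \<rho> x0 * L z" if "z \<in> A" for z
      using that A_tangent[of "fst z" "snd z"] ricci_\<rho>[of "fst z" "snd z"] \<rho>k[of "fst z"] by simp
    ultimately show ?thesis by blast
  qed
qed

end
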